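(* Let $k_x,k_y\ge0$ and let $\mu\in\mathfrak{W}(\mathbb{H};k_x,k_y)$ be a well-projected measure on the upper half-plane $\mathbb{H}$ with projection constants $k_x,k_y$. Let $\mathcal{P}$ be the Poisson integral operator. (a) $\mathcal{P}$ acts continuously from $L^1(\mathbb{R})$ to $L^{1,\infty}(d\mu)$; quantitatively, $$\|\mathcal{P}u\|_{L^{1,\infty}(d\mu)}\le(3k_x+\pi^{-1}k_y)\,\|u\|_{L^1(\mathbb{R})}.$$ (b) Let $1<p\le\infty$ and $p^{-1}+p'^{-1}=1$. The operator $\mathcal{P}$, defined initially on $L^\infty(\mathbb{R})\cap L^p(\mathbb{R})$, extends to a bounded operator from $L^p(\mathbb{R})$ to $L^p(d\mu)$ with the uniform norm estimate $$K_3(p,k_x,k_y):=\sup_{\mu\in\mathfrak{W}(\mathbb{H};k_x,k_y)}\|\mathcal{P}\|_{L^p(\mathbb{R})\to L^p(d\mu)}\le 2\left((3k_x+\pi^{-1}k_y)\,p'\right)^{1/p}.$$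
   Context: $\mathbb{H}=\{z=x+iy: y>0\}$. The Poisson integral of $u$ is $\mathcal{P}u(z)=\int_{\mathbb{R}}P(x-t,y)\,u(t)\,dt$ for $z=x+iy\in\mathbb{H}$, with $P(x,y)=\frac1\pi\frac{y}{x^2+y^2}$. For $A\subset\mathbb{C}$, $A_x$ and $A_y$ denote its orthogonal projections on the coordinate axes and $|A_x|,|A_y|$ their Lebesgue measures. A Borel measure $\mu$ on a domain $D\subset\mathbb{C}$ is well-projected with projection constants $k_x,k_y\ge0$ (written $\mu\in\mathfrak{W}(D;k_x,k_y)$) if $\mu(A)\le k_x|A_x|+k_y|A_y|$ for every Borel set $A\subset D$ for which the right-hand side is finite. $\|v\|_{L^{1,\infty}(d\mu)}=\sup_{\lambda>0}\lambda\,\mu\{z\in\mathbb{H}:|v(z)|>\lambda\}$, and $L^{1,\infty}(d\mu)$ is the space of $\mu$-measurable $v$ with finite such quantity. *)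

theory Defs
  imports "HOL-Probability.Probability"
begin

definition upper_half_plane :: "complex set" where
  "upper_half_plane = {z. Im z > 0}"

definition poisson_kernel :: "real \<Rightarrow> real \<Rightarrow> real" where
  "poisson_kernel x y = (1 / pi) * (y / (x\<^sup>2 + y\<^sup>2))"

definition poisson_integral :: "(real \<Rightarrow> complex) \<Rightarrow> complex \<Rightarrow> complex" where
  "poisson_integral u z =
     (LINT t|lebesgue. complex_of_real (poisson_kernel (Re z - t) (Im z)) * u t)"

text \<open>
  The projections of a Borel set are analytic and hence Lebesgue measurable, so
  \<^const>\<open>emeasure\<close> never takes its default value for non-measurable sets below.
  As usual in measure theory, \<open>0 * \<infinity> = 0\<close>.
\<close>

definition well_projected :: "complex set \<Rightarrow> real \<Rightarrow> real \<Rightarrow> complex measure set" where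
  "well_projected D kx ky =
     {\<mu>. sets \<mu> = sets (restrict_space borel D) \<and>
         (\<forall>A\<in>sets \<mu>.
            ennreal kx * emeasure lebesgue (Re ` A) + ennreal ky * emeasure lebesgue (Im ` A) < \<infinity> \<longrightarrow>
            emeasure \<mu> A
              \<le> ennreal kx * emeasure lebesgue (Re ` A) + ennreal ky * emeasure lebesgue (Im ` A))}"

definition weak_L1_norm :: "'a measure \<Rightarrow> ('a \<Rightarrow> complex) \<Rightarrow> ennreal" where
  "weak_L1_norm M v =
     (SUP l\<in>{0::real<..}. ennreal l * emeasure M {z \<in> space M. norm (v z) > l})"

definition weak_L1_space :: "'a measure \<Rightarrow> ('a \<Rightarrow> complex) set" where
  "weak_L1_space M = {v \<in> borel_measurable M. weak_L1_norm M v < \<infinity>}"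

text \<open>
  Powers of extended nonnegative reals with exponent \<open>a \<ge> 0\<close>, with \<open>x\<^sup>0 = 1\<close> also for \<open>x = 0\<close>
  and \<open>x = \<infinity>\<close>.
\<close>

definition enn_powr :: "ennreal \<Rightarrow> real \<Rightarrow> ennreal" where
  "enn_powr x a =
     (if a = 0 then 1 else if x = \<infinity> then \<infinity> else ennreal (enn2real x powr a))"

text \<open>
  Elements of \<open>L\<^sup>p\<close> are represented by functions, equality in \<open>L\<^sup>p\<close> being equality almost
  everywhere. The exponent is meant to satisfy \<open>1 \<le> p \<le> \<infinity>\<close>.
\<close>

definition Lp_norm :: "ennreal \<Rightarrow> 'a measure \<Rightarrow> ('a \<Rightarrow> complex) \<Rightarrow> ennreal" where
  "Lp_norm p M f =
     (if p = \<infinity> then esssup M (\<lambda>x. ennreal (norm (f x)))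
      else enn_powr (\<integral>\<^sup>+x. ennreal (norm (f x) powr enn2real p) \<partial>M) (1 / enn2real p))"

definition Lp_space :: "ennreal \<Rightarrow> 'a measure \<Rightarrow> ('a \<Rightarrow> complex) set" where
  "Lp_space p M = {f \<in> borel_measurable M. Lp_norm p M f < \<infinity>}"

definition op_norm ::
  "ennreal \<Rightarrow> 'a measure \<Rightarrow> 'b measure \<Rightarrow> (('a \<Rightarrow> complex) \<Rightarrow> ('b \<Rightarrow> complex)) \<Rightarrow> ennreal" where
  "op_norm p M N T = (SUP u\<in>{u \<in> Lp_space p M. Lp_norm p M u \<le> 1}. Lp_norm p N (T u))"

definition bounded_Lp_operator ::
  "ennreal \<Rightarrow> 'a measure \<Rightarrow> 'b measure \<Rightarrow> (('a \<Rightarrow> complex) \<Rightarrow> ('b \<Rightarrow> complex)) \<Rightarrow> bool" where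
  "bounded_Lp_operator p M N T \<longleftrightarrow>
     (\<forall>u\<in>Lp_space p M. T u \<in> Lp_space p N) \<and>
     (\<forall>u\<in>Lp_space p M. \<forall>v\<in>Lp_space p M.
        (AE x in M. u x = v x) \<longrightarrow> (AE z in N. T u z = T v z)) \<and>
     (\<forall>u\<in>Lp_space p M. \<forall>v\<in>Lp_space p M.
        AE z in N. T (\<lambda>x. u x + v x) z = T u z + T v z) \<and>
     (\<forall>c. \<forall>u\<in>Lp_space p M. AE z in N. T (\<lambda>x. c * u x) z = c * T u z) \<and>
     op_norm p M N T < \<infinity>"

text \<open>The bounded extensions to \<open>L\<^sup>p\<close> of the Poisson integral on \<open>L\<^sup>\<infinity> \<inter> L\<^sup>p\<close>.\<close>

definition poisson_extensions ::
  "ennreal \<Rightarrow> complex measure \<Rightarrow> ((real \<Rightarrow> complex) \<Rightarrow> (complex \<Rightarrow> complex)) set" where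
  "poisson_extensions p \<mu> =
     {T. bounded_Lp_operator p lebesgue \<mu> T \<and>
         (\<forall>u \<in> Lp_space \<infinity> lebesgue \<inter> Lp_space p lebesgue.
            AE z in \<mu>. T u z = poisson_integral u z)}"

text \<open>
  Since \<open>L\<^sup>\<infinity> \<inter> L\<^sup>p\<close> is dense in \<open>L\<^sup>p\<close>, the bounded extension is unique up to equality almost
  everywhere, so the inner supremum ranges over a single value, the norm of the extended operator.
\<close>

definition K3 :: "ennreal \<Rightarrow> real \<Rightarrow> real \<Rightarrow> ennreal" where
  "K3 p kx ky =
     (SUP \<mu>\<in>well_projected upper_half_plane kx ky.
        SUP T\<in>poisson_extensions p \<mu>. op_norm p lebesgue \<mu> T)"

end

theory Submission
  imports Defs
begin

text \<open>
  If \<open>P|u|(x + iy) > l\<close>, then \<open>|u|\<close> has an average exceeding \<open>l\<close> over some interval centred at \<open>x\<close>: the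
  kernel is a mixture of normalized indicators of its level sets, which are such intervals. By Vitali's
  covering lemma the set of these \<open>x\<close> is contained in a set of measure at most \<open>3 \<parallel>u\<parallel>\<^sub>1 / l\<close>. Since the kernel
  is at most \<open>1 / (\<pi> y)\<close>, also \<open>y < \<parallel>u\<parallel>\<^sub>1 / (\<pi> l)\<close>. These two projections give the weak type estimate.
  Interpolating it with the trivial \<open>L\<^sup>\<infinity>\<close> bound gives the \<open>L\<^sup>p\<close> estimate for the Poisson
  integral, which converges on all of \<open>L\<^sup>p\<close>. Truncating \<open>u\<close> shows that every bounded extension agrees with it
  almost everywhere.
\<close>

section \<open>A covering lemma\<close>

text \<open>The projections of a level set are hard to describe exactly, so they are only bounded
  through measurable supersets: an open union of intervals and a bounded segment. The maximal
  function never appears as a function; only the intervals with a large average do. The constant 3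
  is the expansion factor of Vitali's selection for finite families, where a ball of largest radius
  exists. It survives for infinite families because these are reached by a monotone limit. With C =
  3 kx + ky / pi, splitting |u| at height l / 2 bounds the measure of {|Pu| > l} by 2 C / l times
  the integral of |u| over {|u| > l / 2}. Integrating against r l^(r - 1) dl gives the factor 2^r C
  r / (r - 1), whose r-th root is the constant of the \<open>L^p\<close> estimate, since r / (r - 1)
  is the conjugate exponent.\<close>

lemma finite_vitali_covering_balls:
  fixes c :: "'i \<Rightarrow> 'a::metric_space" and r :: "'i \<Rightarrow> real"
  assumes "finite I"
  shows "\<exists>J\<subseteq>I. disjoint_family_on (\<lambda>i. ball (c i) (r i)) J \<and>
           (\<Union>i\<in>I. ball (c i) (r i)) \<subseteq> (\<Union>j\<in>J. ball (c j) (3 * r j))"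
  using assms
proof (induction I rule: finite_psubset_induct)
  case (psubset I)
  show ?case
  proof (cases "I = {}")
    case False
    \<comment> \<open>Vitali's greedy choice: keep a ball of largest radius, discard every ball that
      meets it, and recurse on the rest. A discarded ball has radius at most \<open>r m\<close>, so
      it lies within distance \<open>3 * r m\<close> of \<open>c m\<close>.\<close>
    then obtain m where m: "m \<in> I" "\<And>i. i \<in> I \<Longrightarrow> r i \<le> r m"
      using obtains_MAX[OF psubset.hyps False, of r] psubset.hyps by (metis Max_ge finite_imageI imageI)
    define I' where "I' = {i \<in> I - {m}. ball (c i) (r i) \<inter> ball (c m) (r m) = {}}"
    have "I' \<subset> I" using m(1) by (auto simp: I'_def)
    then obtain J where J: "J \<subseteq> I'" "disjoint_family_on (\<lambda>i. ball (c i) (r i)) J"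
      "(\<Union>i\<in>I'. ball (c i) (r i)) \<subseteq> (\<Union>j\<in>J. ball (c j) (3 * r j))"
      using psubset.IH by meson
    have "ball (c i) (r i) \<subseteq> (\<Union>j\<in>insert m J. ball (c j) (3 * r j))" if "i \<in> I" for i
    proof (cases "i \<in> I'")
      case True
      then show ?thesis using J(3) by blast
    next
      case False
      have "ball (c i) (r i) \<subseteq> ball (c m) (3 * r m)"
      proof
        fix x assume x: "x \<in> ball (c i) (r i)"
        obtain y where y: "y \<in> ball (c i) (r i)" "y \<in> ball (c m) (r m)"
          using False \<open>i \<in> I\<close> x by (cases "i = m") (auto simp: I'_def)
        have "dist (c m) x \<le> dist (c m) y + dist (c i) y + dist (c i) x"
          by (metis add.commute add_mono_thms_linordered_semiring(3) dist_commute
              dist_triangle dist_triangle_le group_cancel.add1)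
        moreover have "r i \<le> r m" using m(2) that by blast
        ultimately show "x \<in> ball (c m) (3 * r m)" using x y by auto
      qed
      then show ?thesis by blast
    qed
    moreover have "disjoint_family_on (\<lambda>i. ball (c i) (r i)) (insert m J)"
      using J(1,2) by (auto simp: disjoint_family_on_def I'_def)
    moreover have "insert m J \<subseteq> I" using J(1) m(1) by (auto simp: I'_def)
    ultimately show ?thesis by blast
  qed (auto simp: disjoint_family_on_def)
qed

text \<open>The selected disjoint balls carry \<open>\<nu>\<close>-mass that adds up to at most the
  total mass, and each pays for its threefold enlargement. Keeping \<open>l\<close> as a factor on
  the left avoids division in \<open>ennreal\<close> and admits an infinite total mass.\<close>

lemma emeasure_Union_dense_balls_le:
  fixes F :: "(real \<times> real) set"
  assumes \<nu>: "sets \<nu> = sets lebesgue" and "l > 0"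
    and F: "\<And>c r. (c, r) \<in> F \<Longrightarrow> r > 0 \<and> ennreal (l * (2 * r)) \<le> emeasure \<nu> (ball c r)"
  shows "ennreal l * emeasure lebesgue (\<Union>(c, r)\<in>F. ball c r) \<le> 3 * emeasure \<nu> UNIV"
proof -
  have fin: "ennreal l * emeasure lebesgue (\<Union>(c, r)\<in>I. ball c r) \<le> 3 * emeasure \<nu> UNIV"
    if I: "finite I" "I \<subseteq> F" for I
  proof -
    obtain J where J: "J \<subseteq> I" "disjoint_family_on (\<lambda>i. ball (fst i) (snd i)) J"
      "(\<Union>i\<in>I. ball (fst i) (snd i)) \<subseteq> (\<Union>j\<in>J. ball (fst j) (3 * snd j))"
      using finite_vitali_covering_balls[OF I(1), of fst snd] by blast
    have fJ: "finite J" using J(1) I(1) finite_subset by blast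
    have len: "ennreal l * emeasure lebesgue (ball (fst j) (3 * snd j)) \<le> 3 * emeasure \<nu> (ball (fst j) (snd j))"
      if "j \<in> J" for j
    proof -
      have j: "snd j > 0" "ennreal (l * (2 * snd j)) \<le> emeasure \<nu> (ball (fst j) (snd j))"
        using F[of "fst j" "snd j"] that J(1) I(2) by auto
      have "ennreal l * emeasure lebesgue (ball (fst j) (3 * snd j)) = ennreal l * ennreal (6 * snd j)"
        using j(1) by (simp add: ball_eq_greaterThanLessThan)
      also have "\<dots> = 3 * ennreal (l * (2 * snd j))"
        using \<open>l > 0\<close> j(1) by (simp add: ennreal_mult'[symmetric] flip: ennreal_numeral)
      finally show ?thesis using j(2) by (simp add: mult_left_mono)
    qed
    have "ennreal l * emeasure lebesgue (\<Union>(c, r)\<in>I. ball c r)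
        \<le> ennreal l * emeasure lebesgue (\<Union>j\<in>J. ball (fst j) (3 * snd j))"
      using J(3) fJ by (intro mult_left_mono emeasure_mono) (auto simp: case_prod_unfold)
    also have "\<dots> \<le> ennreal l * (\<Sum>j\<in>J. emeasure lebesgue (ball (fst j) (3 * snd j)))"
      using fJ by (intro mult_left_mono emeasure_subadditive_finite) auto
    also have "\<dots> = (\<Sum>j\<in>J. ennreal l * emeasure lebesgue (ball (fst j) (3 * snd j)))"
      by (rule sum_distrib_left)
    also have "\<dots> \<le> (\<Sum>j\<in>J. 3 * emeasure \<nu> (ball (fst j) (snd j)))"
      using len by (rule sum_mono)
    also have "\<dots> = 3 * (\<Sum>j\<in>J. emeasure \<nu> (ball (fst j) (snd j)))"
      by (rule sum_distrib_left[symmetric])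
    also have "(\<Sum>j\<in>J. emeasure \<nu> (ball (fst j) (snd j))) = emeasure \<nu> (\<Union>j\<in>J. ball (fst j) (snd j))"
      using fJ J(2) by (intro sum_emeasure) (auto simp: \<nu>)
    also have "\<dots> \<le> emeasure \<nu> UNIV"
      using \<nu> by (intro emeasure_mono) (auto simp: sets_eq_imp_space_eq[OF \<nu>])
    finally show ?thesis by (simp add: mult_left_mono)
  qed
  \<comment> \<open>Countably many of the open balls already have the same union, so continuity from
    below carries the finite case over to arbitrary \<open>F\<close>.\<close>
  obtain \<F> where \<F>: "\<F> \<subseteq> (\<lambda>(c, r). ball c r) ` F" "countable \<F>" "\<Union>\<F> = (\<Union>(c, r)\<in>F. ball c r)"
    by (rule Lindelof[of "(\<lambda>(c, r). ball c r) ` F"]) auto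
  show ?thesis
  proof (cases "\<F> = {}")
    case True
    then show ?thesis using \<F>(3) by simp
  next
    case False
    obtain B where B: "\<F> = range (B :: nat \<Rightarrow> real set)"
      using \<F>(2) False by (metis range_from_nat_into)
    then have "\<forall>n. \<exists>d\<in>F. B n = ball (fst d) (snd d)" using \<F>(1) by (auto simp: subset_eq image_iff case_prod_unfold)
    then obtain d where d: "\<And>n. d n \<in> F" "\<And>n. B n = ball (fst (d n)) (snd (d n))" by metis
    let ?U = "\<lambda>n. \<Union>i\<in>d ` {..n}. ball (fst i) (snd i)"
    have "emeasure lebesgue (\<Union>(c, r)\<in>F. ball c r) = emeasure lebesgue (\<Union>n. ?U n)"
      by (rule arg_cong[of _ _ "emeasure lebesgue"]) (auto simp flip: \<F>(3) simp: B d(2))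
    also have "\<dots> = (SUP n. emeasure lebesgue (?U n))"
      by (intro SUP_emeasure_incseq[symmetric]) (force simp: incseq_def)+
    finally have "ennreal l * emeasure lebesgue (\<Union>(c, r)\<in>F. ball c r) = (SUP n. ennreal l * emeasure lebesgue (?U n))"
      by (simp add: SUP_mult_left_ennreal)
    also have "\<dots> \<le> 3 * emeasure \<nu> UNIV"
    proof (intro SUP_least)
      fix n
      have "d ` {..n} \<subseteq> F" using d(1) by auto
      from fin[OF _ this] show "ennreal l * emeasure lebesgue (?U n) \<le> 3 * emeasure \<nu> UNIV"
        unfolding case_prod_unfold by simp
    qed
    finally show ?thesis .
  qed
qed

section \<open>The Poisson kernel\<close>

text \<open>With values in \<open>ennreal\<close> the integral always exists, so \<open>|u|\<close>
  and its truncations can be treated before convergence for complex \<open>u\<close> is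
  settled.\<close>

definition poisson_nn_integral :: "(real \<Rightarrow> ennreal) \<Rightarrow> complex \<Rightarrow> ennreal" where
  "poisson_nn_integral g z =
     (\<integral>\<^sup>+t. ennreal (poisson_kernel (Re z - t) (Im z)) * g t \<partial>lebesgue)"

text \<open>Tonelli's theorem, used for the layer-cake formula and for the interpolation, asks for
  sigma-finiteness of the completed measure. A countable cover for \<open>lborel\<close> serves
  again, since completion keeps its members measurable and their measures unchanged.\<close>

interpretation lebesgue: sigma_finite_measure "lebesgue :: 'a::euclidean_space measure"
proof
  obtain A :: "'a set set" where A: "countable A" "A \<subseteq> sets lborel" "\<Union>A = space lborel"
      "\<forall>a\<in>A. emeasure lborel a \<noteq> \<infinity>"
    using lborel.sigma_finite_countable by blast
  show "\<exists>A::'a set set. countable A \<and> A \<subseteq> sets lebesgue \<and> \<Union>A = space lebesgue \<and>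
      (\<forall>a\<in>A. emeasure lebesgue a \<noteq> \<infinity>)"
    using A by (intro exI[of _ A]) (auto simp: subset_eq)
qed

lemma measurable_lebesgue_ident [measurable]: "(\<lambda>x::'a::euclidean_space. x) \<in> lebesgue \<rightarrow>\<^sub>M borel"
  using measurable_completion[of "\<lambda>x. x" lborel borel] by simp

lemma measurable_poisson_kernel [measurable (raw)]:
  assumes [measurable]: "f \<in> borel_measurable M" "g \<in> borel_measurable M"
  shows "(\<lambda>x. poisson_kernel (f x) (g x)) \<in> borel_measurable M"
  unfolding poisson_kernel_def by measurable

lemma poisson_kernel_nonneg: "y \<ge> 0 \<Longrightarrow> poisson_kernel x y \<ge> 0"
  by (simp add: poisson_kernel_def)

lemma poisson_kernel_le: "y > 0 \<Longrightarrow> poisson_kernel x y \<le> 1 / (pi * y)"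
proof -
  assume "y > 0"
  then have "y / (x\<^sup>2 + y\<^sup>2) \<le> y / y\<^sup>2"
    by (intro divide_left_mono) (auto intro!: mult_pos_pos add_nonneg_pos)
  then have "1 / pi * (y / (x\<^sup>2 + y\<^sup>2)) \<le> 1 / pi * (y / y\<^sup>2)"
    by (intro mult_left_mono) auto
  then show ?thesis using \<open>y > 0\<close> by (simp add: poisson_kernel_def power2_eq_square mult.commute)
qed

text \<open>For \<open>h\<close> above the maximum \<open>1 / (pi * y)\<close> the radicand is
  negative. Isabelle's \<open>sqrt\<close> is odd and strictly increasing on all reals, so the
  radius is then negative, the ball is empty, and one formula covers every level.\<close>

lemma poisson_kernel_level_set:
  assumes "y > 0" "h > 0"
  shows "{t. h < poisson_kernel (x - t) y} = ball x (sqrt (y / (pi * h) - y\<^sup>2))"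
proof -
  have "h < poisson_kernel (x - t) y \<longleftrightarrow> \<bar>x - t\<bar> < sqrt (y / (pi * h) - y\<^sup>2)" for t
  proof -
    have "0 < (x - t)\<^sup>2 + y\<^sup>2" using assms by (simp add: add_nonneg_pos)
    then have "h < poisson_kernel (x - t) y \<longleftrightarrow> (x - t)\<^sup>2 + y\<^sup>2 < y / (pi * h)"
      using assms by (simp add: poisson_kernel_def pos_less_divide_eq mult_ac)
    also have "\<dots> \<longleftrightarrow> \<bar>x - t\<bar> < sqrt (y / (pi * h) - y\<^sup>2)"
      by (metis less_diff_eq real_sqrt_abs real_sqrt_less_iff)
    finally show ?thesis .
  qed
  then show ?thesis by (simp only: ball_def dist_real_def)
qed

text \<open>The kernel is the Cauchy density with scale \<open>y\<close>: the substitution of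
  \<open>x + y * t\<close> for \<open>t\<close> reduces the claim to the integral of 1 / (1 + t^2),
  which is pi.\<close>

lemma nn_integral_poisson_kernel:
  assumes "y > 0"
  shows "(\<integral>\<^sup>+t. ennreal (poisson_kernel (x - t) y) \<partial>lebesgue) = 1"
proof -
  have 1: "integrable lborel (\<lambda>t::real. inverse (1 + t\<^sup>2))" "(\<integral>t. inverse (1 + t\<^sup>2) \<partial>lborel) = pi"
    using integrable_inverse_1_plus_square LBINT_inverse_1_plus_square
    by (simp_all add: set_integrable_def interval_lebesgue_integral_def set_lebesgue_integral_def)
  have "(\<integral>\<^sup>+t. ennreal (poisson_kernel (x - t) y) \<partial>lebesgue) = (\<integral>\<^sup>+t. ennreal (poisson_kernel (x - t) y) \<partial>lborel)"
    by (rule nn_integral_completion)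
  also have "\<dots> = ennreal \<bar>y\<bar> * (\<integral>\<^sup>+t. ennreal (poisson_kernel (x - (x + y * t)) y) \<partial>lborel)"
    using assms by (intro nn_integral_real_affine) auto
  also have "(\<lambda>t. poisson_kernel (x - (x + y * t)) y) = (\<lambda>t. 1 / (pi * y) * inverse (1 + t\<^sup>2))"
  proof
    fix t :: real
    have "1 + t\<^sup>2 > 0" by (simp add: add_pos_nonneg)
    moreover have "(x - (x + y * t))\<^sup>2 + y\<^sup>2 = y\<^sup>2 * (1 + t\<^sup>2)" by algebra
    ultimately show "poisson_kernel (x - (x + y * t)) y = 1 / (pi * y) * inverse (1 + t\<^sup>2)"
      using assms by (simp add: poisson_kernel_def divide_simps power2_eq_square)
  qed
  also have "(\<integral>\<^sup>+t. ennreal (1 / (pi * y) * inverse (1 + t\<^sup>2)) \<partial>lborel) = ennreal (\<integral>t. 1 / (pi * y) * inverse (1 + t\<^sup>2) \<partial>lborel)"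
    using assms 1 by (intro nn_integral_eq_integral) auto
  also have "(\<integral>t. 1 / (pi * y) * inverse (1 + t\<^sup>2) \<partial>lborel) = 1 / y"
    using 1 by simp
  also have "ennreal \<bar>y\<bar> * ennreal (1 / y) = 1"
    using assms by (simp add: ennreal_mult'[symmetric])
  finally show ?thesis .
qed

text \<open>\<open>f x\<close> is the length of the interval from 0 to \<open>f x\<close>, which is
  empty where \<open>f x\<close> is negative, just as \<open>ennreal\<close> cuts off there; then
  Tonelli. Treating the weight \<open>g\<close> as a density allows two weights to be compared level
  by level.\<close>

lemma nn_integral_layer_cake:
  assumes "sigma_finite_measure M" and [measurable]: "f \<in> borel_measurable M" "g \<in> borel_measurable M"
  shows "(\<integral>\<^sup>+x. ennreal (f x) * g x \<partial>M) = (\<integral>\<^sup>+h\<in>{0<..}. emeasure (density M g) {x\<in>space M. h < f x} \<partial>lborel)"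
proof -
  interpret M: sigma_finite_measure M by fact
  interpret pair_sigma_finite M lborel ..
  have "(\<integral>\<^sup>+x. ennreal (f x) * g x \<partial>M) = (\<integral>\<^sup>+x. \<integral>\<^sup>+h. g x * indicator {0<..} h * indicator {..<f x} h \<partial>lborel \<partial>M)"
  proof (rule nn_integral_cong)
    fix x
    have "(\<integral>\<^sup>+h. g x * indicator {0<..} h * indicator {..<f x} h \<partial>lborel) = (\<integral>\<^sup>+h. g x * indicator {0<..<f x} h \<partial>lborel)"
      by (intro nn_integral_cong) (auto simp: indicator_def)
    also have "\<dots> = g x * ennreal (f x)"
      by (cases "f x \<ge> 0") (simp_all add: nn_integral_cmult_indicator ennreal_neg)
    finally show "ennreal (f x) * g x = (\<integral>\<^sup>+h. g x * indicator {0<..} h * indicator {..<f x} h \<partial>lborel)"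
      by (simp add: mult.commute)
  qed
  also have "\<dots> = (\<integral>\<^sup>+h. \<integral>\<^sup>+x. g x * indicator {0<..} h * indicator {..<f x} h \<partial>M \<partial>lborel)"
    by (intro Fubini'[symmetric]) (auto simp: indicator_def[abs_def])
  also have "\<dots> = (\<integral>\<^sup>+h\<in>{0<..}. emeasure (density M g) {x\<in>space M. h < f x} \<partial>lborel)"
  proof (rule nn_integral_cong)
    fix h :: real
    have "(\<integral>\<^sup>+x. g x * indicator {0<..} h * indicator {..<f x} h \<partial>M)
        = (\<integral>\<^sup>+x. (g x * indicator {x\<in>space M. h < f x} x) * indicator {0<..} h \<partial>M)"
      by (intro nn_integral_cong) (auto simp: indicator_def)
    also have "\<dots> = emeasure (density M g) {x\<in>space M. h < f x} * indicator {0<..} h"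
      by (subst nn_integral_multc) (auto simp: emeasure_density)
    finally show "(\<integral>\<^sup>+x. g x * indicator {0<..} h * indicator {..<f x} h \<partial>M)
       = emeasure (density M g) {x\<in>space M. h < f x} * indicator {0<..} h" .
  qed
  finally show ?thesis .
qed

text \<open>The level sets of the kernel are intervals centred at \<open>Re z\<close>. On each of
  them the weight \<open>g\<close> has at most the mass of the constant weight \<open>l\<close>, so
  the Poisson integral of \<open>g\<close> is at most that of \<open>l\<close>, which is
  \<open>l\<close>. The weak type estimate uses the contrapositive.\<close>

lemma poisson_nn_integral_le_of_averages:
  assumes [measurable]: "g \<in> borel_measurable lebesgue" and "Im z > 0" "l \<ge> 0"
    and avg: "\<And>r. r > 0 \<Longrightarrow> emeasure (density lebesgue g) (ball (Re z) r) \<le> ennreal (l * (2 * r))"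
  shows "poisson_nn_integral g z \<le> ennreal l"
proof -
  let ?P = "\<lambda>t. poisson_kernel (Re z - t) (Im z)"
  have "poisson_nn_integral g z = (\<integral>\<^sup>+h\<in>{0<..}. emeasure (density lebesgue g) {t. h < ?P t} \<partial>lborel)"
    unfolding poisson_nn_integral_def
    by (subst nn_integral_layer_cake) (auto intro: lebesgue.sigma_finite_measure_axioms)
  also have "\<dots> \<le> (\<integral>\<^sup>+h\<in>{0<..}. emeasure (density lebesgue (\<lambda>_. ennreal l)) {t\<in>space lebesgue. h < ?P t} \<partial>lborel)"
  proof (intro nn_integral_mono)
    fix h :: real
    show "emeasure (density lebesgue g) {t. h < ?P t} * indicator {0<..} h
       \<le> emeasure (density lebesgue (\<lambda>_. ennreal l)) {t\<in>space lebesgue. h < ?P t} * indicator {0<..} h"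
    proof (cases "h > 0")
      case True
      define r where "r = sqrt (Im z / (pi * h) - (Im z)\<^sup>2)"
      have "emeasure (density lebesgue g) (ball (Re z) r) \<le> emeasure (density lebesgue (\<lambda>_. ennreal l)) (ball (Re z) r)"
      proof (cases "r > 0")
        case True
        then show ?thesis using avg[OF True] \<open>l \<ge> 0\<close>
          by (simp add: ennreal_mult'[symmetric] ball_eq_greaterThanLessThan emeasure_density_const)
      next
        \<comment> \<open>Levels at or above the maximum of the kernel: \<open>avg\<close> says
          nothing here, but the level set is empty.\<close>
        case False
        then have "ball (Re z) r = {}" by simp
        then show ?thesis by (simp only: emeasure_empty order.refl)
      qed
      then show ?thesis
        using poisson_kernel_level_set[OF assms(2) True] True by (simp add: r_def)
    qed simp
  qed
  also have "\<dots> = (\<integral>\<^sup>+t. ennreal (?P t) * ennreal l \<partial>lebesgue)"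
    by (rule nn_integral_layer_cake[symmetric]) (auto intro: lebesgue.sigma_finite_measure_axioms)
  also have "\<dots> = (\<integral>\<^sup>+t. ennreal (?P t) \<partial>lebesgue) * ennreal l"
    by (intro nn_integral_multc) auto
  also have "\<dots> = ennreal l"
    using nn_integral_poisson_kernel[OF assms(2)] by simp
  finally show ?thesis .
qed

lemma borel_measurable_poisson_nn_integral [measurable (raw)]:
  assumes [measurable]: "case_prod G \<in> borel_measurable (N \<Otimes>\<^sub>M lebesgue)" "f \<in> borel_measurable N"
  shows "(\<lambda>w. poisson_nn_integral (G w) (f w)) \<in> borel_measurable N"
  unfolding poisson_nn_integral_def by measurable

lemma poisson_nn_integral_add:
  assumes [measurable]: "g \<in> borel_measurable lebesgue" "h \<in> borel_measurable lebesgue"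
  shows "poisson_nn_integral (\<lambda>t. g t + h t) z = poisson_nn_integral g z + poisson_nn_integral h z"
  unfolding poisson_nn_integral_def by (simp add: distrib_left nn_integral_add)

lemma poisson_nn_integral_const: "Im z > 0 \<Longrightarrow> poisson_nn_integral (\<lambda>_. c) z = c"
  by (simp add: poisson_nn_integral_def nn_integral_multc nn_integral_poisson_kernel)

lemma poisson_nn_integral_mono_AE:
  "AE t in lebesgue. g t \<le> h t \<Longrightarrow> poisson_nn_integral g z \<le> poisson_nn_integral h z"
  unfolding poisson_nn_integral_def by (intro nn_integral_mono_AE) (auto elim!: eventually_mono intro: mult_left_mono)

text \<open>Applied to \<open>g\<close> itself this limits the height of its level sets; applied to
  |u|^r it yields convergence of the Poisson integral on \<open>L^p\<close>.\<close>

lemma poisson_nn_integral_le_nn_integral: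
  assumes [measurable]: "g \<in> borel_measurable lebesgue" and "Im z > 0"
  shows "poisson_nn_integral g z \<le> ennreal (1 / (pi * Im z)) * (\<integral>\<^sup>+t. g t \<partial>lebesgue)"
  unfolding poisson_nn_integral_def
  using assms(2) by (subst nn_integral_cmult[symmetric])
    (auto intro!: nn_integral_mono mult_right_mono ennreal_leI poisson_kernel_le)

section \<open>Estimates for well-projected measures\<close>

lemma well_projected_sets_space:
  assumes "\<mu> \<in> well_projected D kx ky"
  shows "sets \<mu> = sets (restrict_space borel D)" "space \<mu> = D"
proof -
  show *: "sets \<mu> = sets (restrict_space borel D)" using assms by (simp add: well_projected_def)
  show "space \<mu> = D" using sets_eq_imp_space_eq[OF *] by (simp add: space_restrict_space)
qed

lemma measurable_well_projected:
  assumes "\<mu> \<in> well_projected D kx ky" "f \<in> borel_measurable borel"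
  shows "f \<in> borel_measurable \<mu>"
  using measurable_restrict_space1[OF assms(2)] well_projected_sets_space(1)[OF assms(1)]
  by (simp cong: measurable_cong_sets)

text \<open>The real majorants \<open>a\<close> and \<open>b\<close> supply the finiteness under
  which the defining inequality may be used. Monotonicity of \<open>emeasure\<close> asks for
  measurability of the larger set only, so \<open>X\<close> and \<open>Y\<close> stand in for the
  projections.\<close>

lemma well_projected_emeasure_le:
  assumes \<mu>: "\<mu> \<in> well_projected D kx ky" and "kx \<ge> 0" "ky \<ge> 0" and A: "A \<in> sets \<mu>"
    and X: "Re ` A \<subseteq> X" "X \<in> sets lebesgue" "emeasure lebesgue X \<le> ennreal a" "a \<ge> 0"
    and Y: "Im ` A \<subseteq> Y" "Y \<in> sets lebesgue" "emeasure lebesgue Y \<le> ennreal b" "b \<ge> 0"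
  shows "emeasure \<mu> A \<le> ennreal (kx * a + ky * b)"
proof -
  have "emeasure lebesgue (Re ` A) \<le> ennreal a" "emeasure lebesgue (Im ` A) \<le> ennreal b"
    using emeasure_mono[OF X(1,2)] emeasure_mono[OF Y(1,2)] X(3) Y(3) by auto
  then have *: "ennreal kx * emeasure lebesgue (Re ` A) + ennreal ky * emeasure lebesgue (Im ` A)
      \<le> ennreal kx * ennreal a + ennreal ky * ennreal b"
    by (intro add_mono mult_left_mono) auto
  also have eq: "ennreal kx * ennreal a + ennreal ky * ennreal b = ennreal (kx * a + ky * b)"
    using assms by (simp add: ennreal_mult)
  also have "ennreal (kx * a + ky * b) < \<infinity>" by simp
  finally have "ennreal kx * emeasure lebesgue (Re ` A) + ennreal ky * emeasure lebesgue (Im ` A) < \<infinity>" .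
  then have "emeasure \<mu> A \<le> ennreal kx * emeasure lebesgue (Re ` A) + ennreal ky * emeasure lebesgue (Im ` A)"
    using \<mu> A by (simp add: well_projected_def)
  then show ?thesis using * eq by simp
qed

text \<open>The boxes \<open>?A n\<close> exhaust the half-plane, and both of their projections are
  bounded, the vertical one from below by 0.\<close>

lemma well_projected_sigma_finite:
  assumes \<mu>: "\<mu> \<in> well_projected upper_half_plane kx ky" and k: "kx \<ge> 0" "ky \<ge> 0"
  shows "sigma_finite_measure \<mu>"
proof
  let ?A = "\<lambda>n::nat. {z\<in>space \<mu>. \<bar>Re z\<bar> \<le> real n \<and> Im z \<le> real n}"
  have Re: "Re \<in> borel_measurable \<mu>" and Im: "Im \<in> borel_measurable \<mu>"
    by (auto intro!: measurable_well_projected[OF \<mu>])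
  have A: "?A n \<in> sets \<mu>" for n using Re Im by measurable
  have "emeasure \<mu> (?A n) \<noteq> \<infinity>" for n
  proof -
    have "emeasure \<mu> (?A n) \<le> ennreal (kx * (2 * real n) + ky * real n)"
      by (rule well_projected_emeasure_le[OF \<mu> k A, where X = "{- real n..real n}" and Y = "{0..real n}"])
        (auto simp: well_projected_sets_space(2)[OF \<mu>] upper_half_plane_def)
    also have "\<dots> < \<infinity>" by simp
    finally show ?thesis by simp
  qed
  moreover have "z \<in> space \<mu> \<Longrightarrow> \<exists>n. z \<in> ?A n" for z
    using real_arch_simple[of "max \<bar>Re z\<bar> (Im z)"] by auto
  ultimately show "\<exists>A. countable A \<and> A \<subseteq> sets \<mu> \<and> \<Union>A = space \<mu> \<and> (\<forall>a\<in>A. emeasure \<mu> a \<noteq> \<infinity>)"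
    using A by (intro exI[of _ "range ?A"]) auto
qed

lemma poisson_nn_integral_weak_type:
  assumes \<mu>: "\<mu> \<in> well_projected upper_half_plane kx ky" and k: "kx \<ge> 0" "ky \<ge> 0"
    and g[measurable]: "g \<in> borel_measurable lebesgue" and fin: "(\<integral>\<^sup>+t. g t \<partial>lebesgue) < \<infinity>" and "l > 0"
  shows "ennreal l * emeasure \<mu> {z\<in>space \<mu>. ennreal l < poisson_nn_integral g z}
    \<le> ennreal (3 * kx + ky / pi) * (\<integral>\<^sup>+t. g t \<partial>lebesgue)"
proof -
  obtain \<gamma> where \<gamma>: "(\<integral>\<^sup>+t. g t \<partial>lebesgue) = ennreal \<gamma>" "\<gamma> \<ge> 0"
    using fin by (cases "\<integral>\<^sup>+t. g t \<partial>lebesgue") auto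
  define \<nu> where "\<nu> = density lebesgue g"
  have \<nu>: "sets \<nu> = sets lebesgue" "emeasure \<nu> UNIV = ennreal \<gamma>"
    by (simp_all add: \<nu>_def emeasure_density \<gamma>)
  let ?E = "{z\<in>space \<mu>. ennreal l < poisson_nn_integral g z}"
  \<comment> \<open>All intervals of average at least \<open>l\<close>, with no choice of one
    interval per point. Their union is open, hence measurable, whatever the horizontal projection of
    \<open>?E\<close> looks like.\<close>
  define F where "F = {(c, r). r > 0 \<and> ennreal (l * (2 * r)) \<le> emeasure \<nu> (ball c r)}"
  let ?X = "\<Union>(c, r)\<in>F. ball c r"
  have "?X \<in> sets borel" by (intro borel_open open_UN) auto
  then have X: "?X \<in> sets lebesgue" by simp
  have "ennreal l * emeasure lebesgue ?X \<le> 3 * ennreal \<gamma>"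
    using emeasure_Union_dense_balls_le[OF \<nu>(1) \<open>l > 0\<close>, of F] \<nu>(2) by (auto simp: F_def)
  then have "ennreal (1 / l) * (ennreal l * emeasure lebesgue ?X) \<le> ennreal (1 / l) * (3 * ennreal \<gamma>)"
    by (rule mult_left_mono) simp
  also have "ennreal (1 / l) * (ennreal l * emeasure lebesgue ?X) = emeasure lebesgue ?X"
    using \<open>l > 0\<close> by (simp add: mult.assoc[symmetric] ennreal_mult'[symmetric])
  also have "ennreal (1 / l) * (3 * ennreal \<gamma>) = ennreal (3 * \<gamma> / l)"
    using \<open>l > 0\<close> \<gamma>(2) by (simp add: ennreal_mult'[symmetric] flip: ennreal_numeral)
  finally have eX: "emeasure lebesgue ?X \<le> ennreal (3 * \<gamma> / l)" .
  have sX: "Re ` ?E \<subseteq> ?X"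
  proof (intro image_subsetI, rule ccontr)
    fix z assume z: "z \<in> ?E" and nX: "Re z \<notin> ?X"
    \<comment> \<open>A violation at radius \<open>r\<close> would put the interval into
      \<open>F\<close>, and an interval contains its own centre.\<close>
    have "emeasure \<nu> (ball (Re z) r) \<le> ennreal (l * (2 * r))" if "r > 0" for r
    proof (rule ccontr)
      assume "\<not> emeasure \<nu> (ball (Re z) r) \<le> ennreal (l * (2 * r))"
      then have "(Re z, r) \<in> F" using that by (simp add: F_def)
      moreover have "Re z \<in> ball (Re z) r" using that by simp
      ultimately show False using nX by blast
    qed
    then have "poisson_nn_integral g z \<le> ennreal l"
      using z \<open>l > 0\<close> unfolding \<nu>_def
      by (intro poisson_nn_integral_le_of_averages)
        (auto simp: well_projected_sets_space(2)[OF \<mu>] upper_half_plane_def)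
    then show False using z by auto
  qed
  have sY: "Im ` ?E \<subseteq> {0..\<gamma> / (pi * l)}"
  proof (intro image_subsetI)
    fix z assume z: "z \<in> ?E"
    then have y: "Im z > 0" by (auto simp: well_projected_sets_space(2)[OF \<mu>] upper_half_plane_def)
    have "ennreal l < ennreal (1 / (pi * Im z)) * ennreal \<gamma>"
      using poisson_nn_integral_le_nn_integral[OF g y] z \<gamma>(1) by auto
    also have "\<dots> = ennreal (\<gamma> / (pi * Im z))"
      using y \<gamma>(2) by (simp add: ennreal_mult'[symmetric])
    finally have "l < \<gamma> / (pi * Im z)"
      using \<open>l > 0\<close> by (simp add: ennreal_less_iff)
    then show "Im z \<in> {0..\<gamma> / (pi * l)}"
      using y \<open>l > 0\<close> by (simp add: field_simps)
  qed
  have "emeasure \<mu> ?E \<le> ennreal (kx * (3 * \<gamma> / l) + ky * (\<gamma> / (pi * l)))"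
  proof (rule well_projected_emeasure_le[OF \<mu> k _ sX X eX _ sY])
    have "poisson_nn_integral g \<in> borel_measurable \<mu>"
      by (rule measurable_well_projected[OF \<mu>]) measurable
    then show "?E \<in> sets \<mu>" by measurable
  qed (use \<gamma> \<open>l > 0\<close> in auto)
  then have "ennreal l * emeasure \<mu> ?E \<le> ennreal l * ennreal (kx * (3 * \<gamma> / l) + ky * (\<gamma> / (pi * l)))"
    by (rule mult_left_mono) simp
  also have "\<dots> = ennreal (l * (kx * (3 * \<gamma> / l) + ky * (\<gamma> / (pi * l))))"
    using \<open>l > 0\<close> by (simp add: ennreal_mult')
  also have "l * (kx * (3 * \<gamma> / l) + ky * (\<gamma> / (pi * l))) = (3 * kx + ky / pi) * \<gamma>"
    using \<open>l > 0\<close> by (simp add: field_simps)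
  also have "ennreal \<dots> = ennreal (3 * kx + ky / pi) * (\<integral>\<^sup>+t. g t \<partial>lebesgue)"
    using k \<gamma>(2) by (simp add: ennreal_mult \<gamma>(1))
  finally show ?thesis .
qed

section \<open>Power integrals and interpolation\<close>

lemma ennreal_powr_eq_nn_integral:
  assumes "a \<ge> 0" "r > (0::real)"
  shows "ennreal (a powr r) = (\<integral>\<^sup>+l. ennreal (r * l powr (r - 1)) * indicator {0<..<a} l \<partial>lborel)"
proof -
  \<comment> \<open>The integrand may be singular at 0, namely for \<open>r < 1\<close>. This occurs
    when the interpolation applies the formula to its exponent lowered by one.\<close>
  have "((\<lambda>l. r * l powr (r - 1)) has_integral (r * (a powr (r - 1 + 1) / (r - 1 + 1)))) {0..a}"
    using assms by (intro has_integral_mult_right has_integral_powr_from_0) auto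
  then have "((\<lambda>l. r * l powr (r - 1)) has_integral (a powr r)) {0<..<a}"
    using assms(2) by (simp add: has_integral_Icc_iff_Ioo)
  from nn_integral_has_integral_lebesgue'[OF _ this] show ?thesis
    using assms(2) by simp
qed

text \<open>A Chebyshev-type bound: above a positive height \<open>l\<close>, a function is
  dominated by a constant times its r-th power. Hence the high part of an \<open>L^r\<close>
  function lies in \<open>L^1\<close>, where the weak type estimate applies.\<close>

lemma powr_tail_bound:
  fixes a l r :: real
  assumes "0 < l" "l < a" "r > 1"
  shows "a \<le> (1 / l) powr (r - 1) * a powr r"
proof -
  have "1 \<le> (a / l) powr (r - 1)"
    using assms by (intro ge_one_powr_ge_zero) auto
  then have "a * 1 \<le> a * (a / l) powr (r - 1)"
    using assms by (intro mult_left_mono) auto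
  also have "\<dots> = (1 / l) powr (r - 1) * (a powr (r - 1) * a powr 1)"
    using assms by (simp add: powr_divide)
  also have "\<dots> = (1 / l) powr (r - 1) * a powr r"
    using powr_add[of a "r - 1" 1] by simp
  finally show ?thesis by simp
qed

text \<open>Marcinkiewicz interpolation: the truncation at height \<open>l / 2\<close> contributes at most \<open>l / 2\<close> to the
  Poisson integral, since the kernel has integral one.\<close>

lemma poisson_nn_integral_strong_type:
  fixes g :: "real \<Rightarrow> real" and h :: "complex \<Rightarrow> real"
  assumes \<mu>: "\<mu> \<in> well_projected upper_half_plane kx ky" and k: "kx \<ge> 0" "ky \<ge> 0" and "r > 1"
    and [measurable]: "g \<in> borel_measurable lebesgue" and g0: "\<And>t. g t \<ge> 0"
    and fin: "(\<integral>\<^sup>+t. ennreal (g t powr r) \<partial>lebesgue) < \<infinity>"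
    and [measurable]: "h \<in> borel_measurable \<mu>" and h0: "\<And>z. h z \<ge> 0"
    and hg: "\<And>z. z \<in> space \<mu> \<Longrightarrow> ennreal (h z) \<le> poisson_nn_integral (\<lambda>t. ennreal (g t)) z"
  shows "(\<integral>\<^sup>+z. ennreal (h z powr r) \<partial>\<mu>) \<le>
    ennreal (2 powr r * ((3 * kx + ky / pi) * (r / (r - 1)))) * (\<integral>\<^sup>+t. ennreal (g t powr r) \<partial>lebesgue)"
proof -
  interpret M: sigma_finite_measure \<mu> by (rule well_projected_sigma_finite[OF \<mu> k])
  interpret P1: pair_sigma_finite \<mu> lborel ..
  interpret P2: pair_sigma_finite lborel "lebesgue :: real measure" ..
  define C where "C = 3 * kx + ky / pi"
  have C: "C \<ge> 0" using k by (simp add: C_def)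
  have [measurable]: "(\<lambda>t. indicator {0<..<2 * g t} l :: ennreal) \<in> borel_measurable lebesgue" for l
    unfolding indicator_def greaterThanLessThan_iff by measurable
  have weak: "ennreal l * emeasure \<mu> {z\<in>space \<mu>. l < h z}
      \<le> ennreal (2 * C) * (\<integral>\<^sup>+t. ennreal (g t) * indicator {0<..<2 * g t} l \<partial>lebesgue)"
    if "l > 0" for l
  proof -
    let ?g = "\<lambda>t. ennreal (g t) * indicator {0<..<2 * g t} l"
    have "(\<integral>\<^sup>+t. ?g t \<partial>lebesgue) \<le> (\<integral>\<^sup>+t. ennreal ((2 / l) powr (r - 1)) * ennreal (g t powr r) \<partial>lebesgue)"
    proof (intro nn_integral_mono)
      fix t
      show "?g t \<le> ennreal ((2 / l) powr (r - 1)) * ennreal (g t powr r)"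
        using powr_tail_bound[of "l / 2" "g t" r] \<open>r > 1\<close> that
        by (auto simp: indicator_def ennreal_mult'[symmetric] intro!: ennreal_leI)
    qed
    also have "\<dots> < \<infinity>"
      using fin by (subst nn_integral_cmult) (auto simp: ennreal_mult_less_top)
    finally have finl: "(\<integral>\<^sup>+t. ?g t \<partial>lebesgue) < \<infinity>" .
    have "poisson_nn_integral (\<lambda>t. ennreal (g t)) z \<le> poisson_nn_integral ?g z + ennreal (l / 2)"
      if "z \<in> space \<mu>" for z
    proof -
      have "poisson_nn_integral (\<lambda>t. ennreal (g t)) z \<le> poisson_nn_integral (\<lambda>t. ?g t + ennreal (l / 2)) z"
        using \<open>l > 0\<close> by (intro poisson_nn_integral_mono_AE AE_I2) (auto simp: indicator_def intro!: ennreal_leI)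
      also have "\<dots> = poisson_nn_integral ?g z + poisson_nn_integral (\<lambda>_. ennreal (l / 2)) z"
        by (rule poisson_nn_integral_add) auto
      also have "poisson_nn_integral (\<lambda>_. ennreal (l / 2)) z = ennreal (l / 2)"
        using that by (intro poisson_nn_integral_const)
          (simp add: well_projected_sets_space(2)[OF \<mu>] upper_half_plane_def)
      finally show ?thesis .
    qed
    then have "ennreal (l / 2) < poisson_nn_integral ?g z" if "z \<in> space \<mu>" "l < h z" for z
    proof -
      \<comment> \<open>The low part accounts for at most half of the level \<open>l\<close>, so the
        high part \<open>?g\<close> must exceed the other half.\<close>
      have "ennreal (l / 2) + ennreal (l / 2) = ennreal l"
        using \<open>l > 0\<close> by (simp flip: ennreal_plus)
      also have "\<dots> < ennreal (h z)" using that \<open>l > 0\<close> by (simp add: ennreal_less_iff)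
      also have "\<dots> \<le> poisson_nn_integral ?g z + ennreal (l / 2)"
        using hg[OF that(1)] \<open>\<And>z. z \<in> space \<mu> \<Longrightarrow> _ \<le> poisson_nn_integral ?g z + _\<close>[OF that(1)] by order
      finally show ?thesis
        by (metis add_right_mono not_le)
    qed
    then have "emeasure \<mu> {z\<in>space \<mu>. l < h z} \<le> emeasure \<mu> {z\<in>space \<mu>. ennreal (l / 2) < poisson_nn_integral ?g z}"
    proof (intro emeasure_mono)
      have "poisson_nn_integral ?g \<in> borel_measurable \<mu>"
        by (rule measurable_well_projected[OF \<mu>]) measurable
      then show "{z\<in>space \<mu>. ennreal (l / 2) < poisson_nn_integral ?g z} \<in> sets \<mu>" by measurable
    qed auto
    then have "ennreal l * emeasure \<mu> {z\<in>space \<mu>. l < h z}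
        \<le> ennreal l * emeasure \<mu> {z\<in>space \<mu>. ennreal (l / 2) < poisson_nn_integral ?g z}"
      by (rule mult_left_mono) simp
    also have "\<dots> = 2 * (ennreal (l / 2) * emeasure \<mu> {z\<in>space \<mu>. ennreal (l / 2) < poisson_nn_integral ?g z})"
      using \<open>l > 0\<close> by (simp add: mult.assoc[symmetric] ennreal_mult'[symmetric] flip: ennreal_numeral)
    also have "\<dots> \<le> 2 * (ennreal C * (\<integral>\<^sup>+t. ?g t \<partial>lebesgue))"
      unfolding C_def using \<open>l > 0\<close> finl
      by (intro mult_left_mono poisson_nn_integral_weak_type[OF \<mu> k]) auto
    also have "\<dots> = ennreal (2 * C) * (\<integral>\<^sup>+t. ?g t \<partial>lebesgue)"
      using C by (simp add: mult.assoc ennreal_mult)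
    finally show ?thesis .
  qed
  have "(\<integral>\<^sup>+z. ennreal (h z powr r) \<partial>\<mu>)
      = (\<integral>\<^sup>+z. \<integral>\<^sup>+l. ennreal (r * l powr (r - 1)) * indicator {0<..<h z} l \<partial>lborel \<partial>\<mu>)"
    using \<open>r > 1\<close> by (intro nn_integral_cong ennreal_powr_eq_nn_integral h0) auto
  also have "\<dots> = (\<integral>\<^sup>+l. \<integral>\<^sup>+z. ennreal (r * l powr (r - 1)) * indicator {0<..<h z} l \<partial>\<mu> \<partial>lborel)"
    by (intro P1.Fubini'[symmetric]) (auto simp: indicator_def[abs_def])
  \<comment> \<open>One factor \<open>l\<close> of \<open>l powr (r - 1)\<close> is spent on the
    weak type bound. The remaining coefficient \<open>2 * C * r\<close> is split as
    \<open>2 * C * r / (r - 1)\<close> times \<open>r - 1\<close>, so that the later integration in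
    \<open>l\<close> is the power formula with exponent \<open>r - 1\<close>.\<close>
  also have "\<dots> \<le> (\<integral>\<^sup>+l. \<integral>\<^sup>+t. ennreal (2 * C * r / (r - 1)) * (ennreal ((r - 1) * l powr (r - 1 - 1)) *
      (ennreal (g t) * indicator {0<..<2 * g t} l)) \<partial>lebesgue \<partial>lborel)"
  proof (intro nn_integral_mono)
    fix l :: real
    show "(\<integral>\<^sup>+z. ennreal (r * l powr (r - 1)) * indicator {0<..<h z} l \<partial>\<mu>) \<le>
      (\<integral>\<^sup>+t. ennreal (2 * C * r / (r - 1)) * (ennreal ((r - 1) * l powr (r - 1 - 1)) *
      (ennreal (g t) * indicator {0<..<2 * g t} l)) \<partial>lebesgue)" (is "?L \<le> ?R")
    proof (cases "l > 0")
      case True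
      have pw: "l powr (r - 1) = l powr (r - 1 - 1) * l"
        using True powr_add[of l "r - 1 - 1" 1] by simp
      have "?L = (\<integral>\<^sup>+z. ennreal (r * l powr (r - 1)) * indicator {z\<in>space \<mu>. l < h z} z \<partial>\<mu>)"
        using True by (intro nn_integral_cong) (auto simp: indicator_def)
      also have "\<dots> = ennreal (r * l powr (r - 1)) * emeasure \<mu> {z\<in>space \<mu>. l < h z}"
        by (rule nn_integral_cmult_indicator) measurable
      also have "\<dots> = ennreal (r * l powr (r - 1 - 1)) * (ennreal l * emeasure \<mu> {z\<in>space \<mu>. l < h z})"
        using True \<open>r > 1\<close> by (simp add: pw ennreal_mult mult_ac)
      also have "\<dots> \<le> ennreal (r * l powr (r - 1 - 1)) * (ennreal (2 * C) * (\<integral>\<^sup>+t. ennreal (g t) * indicator {0<..<2 * g t} l \<partial>lebesgue))"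
        by (intro mult_left_mono weak True) simp
      also have "\<dots> = (ennreal (2 * C * r / (r - 1)) * ennreal ((r - 1) * l powr (r - 1 - 1))) * (\<integral>\<^sup>+t. ennreal (g t) * indicator {0<..<2 * g t} l \<partial>lebesgue)"
        using C \<open>r > 1\<close> by (simp add: mult.assoc[symmetric] ennreal_mult'[symmetric]) (simp add: mult_ac)
      also have "\<dots> = ?R"
        by (simp add: nn_integral_cmult mult.assoc)
      finally show ?thesis .
    next
      case False
      then have "?L = (\<integral>\<^sup>+z. 0 \<partial>\<mu>)"
        by (intro nn_integral_cong) (auto simp: indicator_def)
      then show ?thesis by simp
    qed
  qed
  also have "\<dots> = (\<integral>\<^sup>+t. \<integral>\<^sup>+l. ennreal (2 * C * r / (r - 1)) * (ennreal ((r - 1) * l powr (r - 1 - 1)) *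
      (ennreal (g t) * indicator {0<..<2 * g t} l)) \<partial>lborel \<partial>lebesgue)"
    by (intro P2.Fubini'[symmetric]) (auto simp: indicator_def[abs_def])
  also have "\<dots> = (\<integral>\<^sup>+t. ennreal (2 powr r * (C * (r / (r - 1)))) * ennreal (g t powr r) \<partial>lebesgue)"
  proof (intro nn_integral_cong)
    fix t
    have "(\<integral>\<^sup>+l. ennreal (2 * C * r / (r - 1)) * (ennreal ((r - 1) * l powr (r - 1 - 1)) *
        (ennreal (g t) * indicator {0<..<2 * g t} l)) \<partial>lborel)
      = (\<integral>\<^sup>+l. (ennreal (2 * C * r / (r - 1)) * ennreal (g t)) * (ennreal ((r - 1) * l powr (r - 1 - 1)) *
         indicator {0<..<2 * g t} l) \<partial>lborel)"
      by (simp add: mult_ac)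
    also have "\<dots> = (ennreal (2 * C * r / (r - 1)) * ennreal (g t)) * ennreal ((2 * g t) powr (r - 1))"
      using \<open>r > 1\<close> g0 by (subst nn_integral_cmult) (auto simp: ennreal_powr_eq_nn_integral)
    also have "\<dots> = ennreal (2 * C * r / (r - 1) * g t * (2 * g t) powr (r - 1))"
    proof -
      have "0 \<le> 2 * C * r / (r - 1)" using \<open>r > 1\<close> C by simp
      then show ?thesis by (simp only: ennreal_mult g0 mult_nonneg_nonneg powr_ge_zero)
    qed
    \<comment> \<open>The power formula had endpoint \<open>2 * g t\<close>; the 2 in front
      completes \<open>2 powr (r - 1)\<close> to \<open>2 powr r\<close>, and \<open>g t\<close>
      completes the power of \<open>g t\<close> likewise.\<close>
    also have "2 * C * r / (r - 1) * g t * (2 * g t) powr (r - 1) = 2 powr r * (C * (r / (r - 1))) * g t powr r"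
    proof -
      have "(2 * g t) powr (r - 1) = 2 powr (r - 1) * g t powr (r - 1)"
        using g0 by (simp add: powr_mult)
      moreover have "g t powr r = g t powr (r - 1) * g t"
        using powr_add[of "g t" "r - 1" 1] g0 by simp
      moreover have "2 powr r = 2 powr (r - 1) * (2::real)"
        using powr_add[of 2 "r - 1" 1] by simp
      ultimately show ?thesis by (simp only: times_divide_eq_left times_divide_eq_right mult_ac)
    qed
    also have "ennreal \<dots> = ennreal (2 powr r * (C * (r / (r - 1)))) * ennreal (g t powr r)"
    proof -
      have "0 \<le> 2 powr r * (C * (r / (r - 1)))" using \<open>r > 1\<close> C by simp
      then show ?thesis by (rule ennreal_mult) simp
    qed
    finally show "(\<integral>\<^sup>+l. ennreal (2 * C * r / (r - 1)) * (ennreal ((r - 1) * l powr (r - 1 - 1)) *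
        (ennreal (g t) * indicator {0<..<2 * g t} l)) \<partial>lborel)
      = ennreal (2 powr r * (C * (r / (r - 1)))) * ennreal (g t powr r)" .
  qed
  also have "\<dots> = ennreal (2 powr r * (C * (r / (r - 1)))) * (\<integral>\<^sup>+t. ennreal (g t powr r) \<partial>lebesgue)"
    by (rule nn_integral_cmult) measurable
  finally show ?thesis by (simp add: C_def)
qed

section \<open>Bounded operators on Lebesgue spaces\<close>

lemma enn_powr_1 [simp]: "enn_powr x 1 = x"
  by (cases x) (auto simp: enn_powr_def)

lemma enn_powr_ennreal: "a \<noteq> 0 \<Longrightarrow> x \<ge> 0 \<Longrightarrow> enn_powr (ennreal x) a = ennreal (x powr a)"
  by (simp add: enn_powr_def)

lemma enn_powr_mono: "a > 0 \<Longrightarrow> x \<le> y \<Longrightarrow> enn_powr x a \<le> enn_powr y a"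
  by (cases x; cases y) (auto simp: enn_powr_def top_unique intro!: ennreal_leI powr_mono2)

lemma enn_powr_less_top_iff: "a > 0 \<Longrightarrow> enn_powr x a < \<infinity> \<longleftrightarrow> x < \<infinity>"
  by (cases x) (auto simp: enn_powr_def)

text \<open>Norm bounds become bounds on integrals of r-th powers, where the linear arithmetic of
  integrals is available.\<close>

lemma enn_powr_le_ennreal_iff:
  assumes "a > 0" "b \<ge> 0"
  shows "enn_powr x a \<le> ennreal b \<longleftrightarrow> x \<le> ennreal (b powr (1 / a))"
proof (cases x)
  case (real y)
  have "y powr a \<le> b \<longleftrightarrow> y \<le> b powr (1 / a)"
  proof
    assume "y powr a \<le> b"
    then have "(y powr a) powr (1 / a) \<le> b powr (1 / a)" using assms by (intro powr_mono2) auto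
    then show "y \<le> b powr (1 / a)" using assms real(1) by (simp add: powr_powr)
  next
    assume "y \<le> b powr (1 / a)"
    then have "y powr a \<le> (b powr (1 / a)) powr a" using assms real(1) by (intro powr_mono2) auto
    then show "y powr a \<le> b" using assms by (simp add: powr_powr)
  qed
  then show ?thesis using assms real by (simp add: enn_powr_ennreal)
qed (use assms in \<open>auto simp: enn_powr_def top_unique\<close>)

section \<open>Norms and spaces for finite exponents\<close>

lemma Lp_norm_ennreal:
  "r > 0 \<Longrightarrow> Lp_norm (ennreal r) M f = enn_powr (\<integral>\<^sup>+x. ennreal (norm (f x) powr r) \<partial>M) (1 / r)"
  by (simp add: Lp_norm_def)

lemma Lp_norm_1: "Lp_norm 1 M f = (\<integral>\<^sup>+x. ennreal (norm (f x)) \<partial>M)"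
  using Lp_norm_ennreal[of 1 M f] by simp

lemma Lp_space_ennreal_iff:
  "r > 0 \<Longrightarrow> f \<in> Lp_space (ennreal r) M \<longleftrightarrow>
     f \<in> borel_measurable M \<and> (\<integral>\<^sup>+x. ennreal (norm (f x) powr r) \<partial>M) < \<infinity>"
  by (simp only: Lp_space_def mem_Collect_eq Lp_norm_ennreal enn_powr_less_top_iff zero_less_divide_1_iff)

lemma Lp_norm_ennreal_le_1_iff:
  "r > 0 \<Longrightarrow> Lp_norm (ennreal r) M f \<le> 1 \<longleftrightarrow> (\<integral>\<^sup>+x. ennreal (norm (f x) powr r) \<partial>M) \<le> 1"
  using enn_powr_le_ennreal_iff[of "1 / r" 1] by (simp add: Lp_norm_ennreal)

lemma Lp_norm_cong_AE:
  assumes "f \<in> borel_measurable M" "g \<in> borel_measurable M" "AE x in M. f x = g x"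
  shows "Lp_norm p M f = Lp_norm p M g"
proof -
  have "esssup M (\<lambda>x. ennreal (norm (f x))) = esssup M (\<lambda>x. ennreal (norm (g x)))"
    using assms by (intro esssup_AE_cong) auto
  moreover have "(\<integral>\<^sup>+x. ennreal (norm (f x) powr s) \<partial>M) = (\<integral>\<^sup>+x. ennreal (norm (g x) powr s) \<partial>M)" for s
    using assms(3) by (intro nn_integral_cong_AE) auto
  ultimately show ?thesis by (simp add: Lp_norm_def)
qed

lemma Lp_space_mult:
  assumes "r > 0" "f \<in> Lp_space (ennreal r) M"
  shows "(\<lambda>x. c * f x) \<in> Lp_space (ennreal r) M"
    and "(\<integral>\<^sup>+x. ennreal (norm (c * f x) powr r) \<partial>M) =
      ennreal (norm c powr r) * (\<integral>\<^sup>+x. ennreal (norm (f x) powr r) \<partial>M)"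
proof -
  have [measurable]: "f \<in> borel_measurable M" using assms by (simp add: Lp_space_def)
  show *: "(\<integral>\<^sup>+x. ennreal (norm (c * f x) powr r) \<partial>M) =
      ennreal (norm c powr r) * (\<integral>\<^sup>+x. ennreal (norm (f x) powr r) \<partial>M)"
    by (simp add: norm_mult powr_mult ennreal_mult nn_integral_cmult)
  show "(\<lambda>x. c * f x) \<in> Lp_space (ennreal r) M"
    using assms unfolding Lp_space_ennreal_iff[OF assms(1)] * by (auto simp: ennreal_mult_less_top)
qed

section \<open>Bounded operators are determined by their values on bounded functions\<close>

lemma bounded_Lp_operator_add:
  "bounded_Lp_operator p M N T \<Longrightarrow> u \<in> Lp_space p M \<Longrightarrow> v \<in> Lp_space p M \<Longrightarrow>
    AE z in N. T (\<lambda>x. u x + v x) z = T u z + T v z"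
  by (simp add: bounded_Lp_operator_def)

lemma bounded_Lp_operator_mult:
  "bounded_Lp_operator p M N T \<Longrightarrow> u \<in> Lp_space p M \<Longrightarrow> AE z in N. T (\<lambda>x. c * u x) z = c * T u z"
  by (simp add: bounded_Lp_operator_def)

text \<open>\<open>op_norm\<close> only controls the unit ball; homogeneity extends this by
  rescaling. The free factor \<open>c\<close> replaces division by the norm of \<open>v\<close>,
  which may vanish, and it can be taken large when \<open>v\<close> is small.\<close>

lemma bounded_Lp_operator_homogeneous_bound:
  assumes T: "bounded_Lp_operator (ennreal r) M N T" and r: "r > 0"
  obtains D where "\<And>v c. v \<in> Lp_space (ennreal r) M \<Longrightarrow> c > 0 \<Longrightarrow>
      ennreal c * (\<integral>\<^sup>+x. ennreal (norm (v x) powr r) \<partial>M) \<le> 1 \<Longrightarrow>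
      ennreal c * (\<integral>\<^sup>+x. ennreal (norm (T v x) powr r) \<partial>N) \<le> ennreal D"
proof -
  obtain b where b: "op_norm (ennreal r) M N T = ennreal b" "b \<ge> 0"
    using T by (cases "op_norm (ennreal r) M N T") (auto simp: bounded_Lp_operator_def)
  show thesis
  proof (rule that[of "b powr r"])
    fix v and c :: real
    assume v: "v \<in> Lp_space (ennreal r) M" "c > 0"
      "ennreal c * (\<integral>\<^sup>+x. ennreal (norm (v x) powr r) \<partial>M) \<le> 1"
    \<comment> \<open>Scaling by the r-th root of \<open>c\<close> multiplies the integral of the
      r-th power by \<open>c\<close>.\<close>
    let ?d = "complex_of_real (c powr (1 / r))"
    have d: "norm ?d powr r = c" using v(2) r by (simp add: powr_powr)
    have Tv: "T v \<in> Lp_space (ennreal r) N" using T v(1) by (simp add: bounded_Lp_operator_def)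
    have dv: "(\<lambda>x. ?d * v x) \<in> Lp_space (ennreal r) M" using Lp_space_mult(1)[OF r v(1)] .
    moreover have "Lp_norm (ennreal r) M (\<lambda>x. ?d * v x) \<le> 1"
      unfolding Lp_norm_ennreal_le_1_iff[OF r] Lp_space_mult(2)[OF r v(1)] d by (rule v(3))
    ultimately have "Lp_norm (ennreal r) N (T (\<lambda>x. ?d * v x)) \<le> ennreal b"
      unfolding b(1)[symmetric] op_norm_def by (intro SUP_upper) auto
    then have *: "(\<integral>\<^sup>+x. ennreal (norm (T (\<lambda>x. ?d * v x) x) powr r) \<partial>N) \<le> ennreal (b powr r)"
      using enn_powr_le_ennreal_iff[of "1 / r" b] r b(2) by (simp add: Lp_norm_ennreal)
    have "AE x in N. T (\<lambda>x. ?d * v x) x = ?d * T v x"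
      by (rule bounded_Lp_operator_mult[OF T v(1)])
    then have "(\<integral>\<^sup>+x. ennreal (norm (T (\<lambda>x. ?d * v x) x) powr r) \<partial>N)
        = (\<integral>\<^sup>+x. ennreal (norm (?d * T v x) powr r) \<partial>N)"
      by (intro nn_integral_cong_AE) auto
    also have "\<dots> = ennreal c * (\<integral>\<^sup>+x. ennreal (norm (T v x) powr r) \<partial>N)"
      unfolding Lp_space_mult(2)[OF r Tv] d ..
    finally show "ennreal c * (\<integral>\<^sup>+x. ennreal (norm (T v x) powr r) \<partial>N) \<le> ennreal (b powr r)"
      using * by simp
  qed
qed

text \<open>The difference is at most twice the larger norm. This crude substitute for Minkowski's
  inequality suffices, because the constant disappears in a limit.\<close>

lemma norm_diff_powr_le:
  fixes a b :: "'a::real_normed_vector"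
  assumes "r > 0"
  shows "norm (a - b) powr r \<le> 2 powr r * (norm a powr r + norm b powr r)"
proof -
  have "norm (a - b) \<le> 2 * max (norm a) (norm b)"
    using norm_triangle_ineq4[of a b] by linarith
  then have "norm (a - b) powr r \<le> (2 * max (norm a) (norm b)) powr r"
    using assms by (intro powr_mono2) auto
  also have "\<dots> = 2 powr r * max (norm a) (norm b) powr r"
    by (simp add: powr_mult)
  also have "max (norm a) (norm b) powr r \<le> norm a powr r + norm b powr r"
    by (auto simp: max_def)
  finally show ?thesis by simp
qed

lemma ennreal_eq_0_of_bounded_multiples:
  fixes s :: ennreal
  assumes "\<And>c. c > 0 \<Longrightarrow> ennreal c * s \<le> ennreal D"
  shows "s = 0"
proof (cases s)
  case (real x)
  show ?thesis
  proof (rule ccontr)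
    assume "s \<noteq> 0"
    then have "x > 0" using real by (cases "x = 0") auto
    \<comment> \<open>This multiple exceeds \<open>D\<close>, also when \<open>D\<close> is
      negative.\<close>
    then have "ennreal ((\<bar>D\<bar> + 1) / x) * s = ennreal (\<bar>D\<bar> + 1)"
      using real by (simp add: ennreal_mult'[symmetric])
    moreover have "ennreal ((\<bar>D\<bar> + 1) / x) * s \<le> ennreal D"
      using \<open>x > 0\<close> by (intro assms) simp
    ultimately show False by (auto simp add: ennreal_le_iff2 simp del: ennreal_plus)
  qed
next
  case top
  then show ?thesis using assms[of 1] by (simp add: top_unique)
qed

text \<open>\<open>v n\<close> is the part of \<open>u\<close> above height \<open>n\<close>, so
  what remains is bounded by \<open>n\<close>. At each point \<open>v n\<close> vanishes for large
  \<open>n\<close>, and |u|^r dominates: the density of bounded functions in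
  \<open>L^r\<close>.\<close>

lemma Lp_space_truncation:
  assumes r: "r > 0" and u: "u \<in> Lp_space (ennreal r) M"
  obtains v :: "nat \<Rightarrow> 'a \<Rightarrow> complex" where "\<And>n. v n \<in> Lp_space (ennreal r) M"
    and "\<And>n. (\<lambda>x. u x - v n x) \<in> Lp_space \<infinity> M \<inter> Lp_space (ennreal r) M"
    and "(\<lambda>n. \<integral>\<^sup>+x. ennreal (norm (v n x) powr r) \<partial>M) \<longlonglongrightarrow> 0"
proof
  define v where "v = (\<lambda>n x. if norm (u x) \<le> real n then 0 else u x)"
  have [measurable]: "u \<in> borel_measurable M" and fin: "(\<integral>\<^sup>+x. ennreal (norm (u x) powr r) \<partial>M) < \<infinity>"
    using u by (simp_all add: Lp_space_ennreal_iff[OF r])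
  have vm [measurable]: "v n \<in> borel_measurable M" for n unfolding v_def by measurable
  have "(\<integral>\<^sup>+x. ennreal (norm (v n x) powr r) \<partial>M) \<le> (\<integral>\<^sup>+x. ennreal (norm (u x) powr r) \<partial>M)" for n
    by (intro nn_integral_mono) (auto simp: v_def)
  then show "v n \<in> Lp_space (ennreal r) M" for n
    using fin by (auto simp: Lp_space_ennreal_iff[OF r] vm intro: le_less_trans)
  have "(\<integral>\<^sup>+x. ennreal (norm (u x - v n x) powr r) \<partial>M) \<le> (\<integral>\<^sup>+x. ennreal (norm (u x) powr r) \<partial>M)" for n
    by (intro nn_integral_mono) (auto simp: v_def)
  then have 1: "(\<lambda>x. u x - v n x) \<in> Lp_space (ennreal r) M" for n
    using fin by (auto simp: Lp_space_ennreal_iff[OF r] intro: le_less_trans)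
  have esssup_bound: "esssup M (\<lambda>x. ennreal (norm (u x - v n x))) \<le> ennreal (real n)" for n
    by (intro esssup_I) (auto simp: v_def intro: ennreal_leI)
  have "(\<lambda>x. u x - v n x) \<in> Lp_space \<infinity> M" for n
  proof -
    have "ennreal (real n) < \<infinity>" by simp
    then have "esssup M (\<lambda>x. ennreal (norm (u x - v n x))) < \<infinity>"
      using esssup_bound by (rule le_less_trans[rotated])
    then show ?thesis by (simp add: Lp_space_def Lp_norm_def)
  qed
  with 1 show "(\<lambda>x. u x - v n x) \<in> Lp_space \<infinity> M \<inter> Lp_space (ennreal r) M" for n by simp
  have "(\<lambda>n. \<integral>\<^sup>+x. ennreal (norm (v n x) powr r) \<partial>M) \<longlonglongrightarrow> (\<integral>\<^sup>+x. 0 \<partial>M)"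
  proof (rule nn_integral_dominated_convergence[where w = "\<lambda>x. ennreal (norm (u x) powr r)"])
    show "AE x in M. (\<lambda>n. ennreal (norm (v n x) powr r)) \<longlonglongrightarrow> 0"
    proof (intro AE_I2 tendsto_eventually)
      fix x
      show "\<forall>\<^sub>F n in sequentially. ennreal (norm (v n x) powr r) = 0"
        using eventually_ge_at_top[of "nat \<lceil>norm (u x)\<rceil>"] by eventually_elim (auto simp: v_def)
    qed
  qed (use fin in \<open>auto simp: v_def\<close>)
  then show "(\<lambda>n. \<integral>\<^sup>+x. ennreal (norm (v n x) powr r) \<partial>M) \<longlonglongrightarrow> 0" by simp
qed

text \<open>Since \<open>S\<close> and \<open>T\<close> agree on the bounded part
  \<open>u - v n\<close>, they differ on \<open>u\<close> exactly as they do on \<open>v n\<close>.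
  For each \<open>c\<close> some \<open>n\<close> makes the integral of |v n|^r at most 1 / c; then
  \<open>c\<close> times the integral of |S u - T u|^r stays bounded for all \<open>c\<close>, so
  that integral is 0.\<close>

lemma bounded_Lp_operator_eqI:
  assumes S: "bounded_Lp_operator (ennreal r) M N S" and T: "bounded_Lp_operator (ennreal r) M N T"
    and r: "r > 0"
    and eq: "\<And>u. u \<in> Lp_space \<infinity> M \<inter> Lp_space (ennreal r) M \<Longrightarrow> AE z in N. S u z = T u z"
    and u: "u \<in> Lp_space (ennreal r) M"
  shows "AE z in N. S u z = T u z"
proof -
  obtain v where v: "\<And>n::nat. v n \<in> Lp_space (ennreal r) M"
    "\<And>n. (\<lambda>x. u x - v n x) \<in> Lp_space \<infinity> M \<inter> Lp_space (ennreal r) M"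
    "(\<lambda>n. \<integral>\<^sup>+x. ennreal (norm (v n x) powr r) \<partial>M) \<longlonglongrightarrow> 0"
    using Lp_space_truncation[OF r u] by blast
  obtain D where D: "\<And>v c. v \<in> Lp_space (ennreal r) M \<Longrightarrow> c > 0 \<Longrightarrow>
      ennreal c * (\<integral>\<^sup>+x. ennreal (norm (v x) powr r) \<partial>M) \<le> 1 \<Longrightarrow>
      ennreal c * (\<integral>\<^sup>+x. ennreal (norm (S v x) powr r) \<partial>N) \<le> ennreal D"
    using bounded_Lp_operator_homogeneous_bound[OF S r] by blast
  obtain E where E: "\<And>v c. v \<in> Lp_space (ennreal r) M \<Longrightarrow> c > 0 \<Longrightarrow>
      ennreal c * (\<integral>\<^sup>+x. ennreal (norm (v x) powr r) \<partial>M) \<le> 1 \<Longrightarrow>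
      ennreal c * (\<integral>\<^sup>+x. ennreal (norm (T v x) powr r) \<partial>N) \<le> ennreal E"
    using bounded_Lp_operator_homogeneous_bound[OF T r] by blast
  have meas [measurable]: "S w \<in> borel_measurable N" "T w \<in> borel_measurable N"
    if "w \<in> Lp_space (ennreal r) M" for w
    using S T that by (auto simp: bounded_Lp_operator_def Lp_space_def)
  have Su [measurable]: "S u \<in> borel_measurable N" "T u \<in> borel_measurable N" using meas u by auto
  let ?s = "\<integral>\<^sup>+z. ennreal (norm (S u z - T u z) powr r) \<partial>N"
  have "?s = 0"
  proof (rule ennreal_eq_0_of_bounded_multiples[where D = "2 powr r * (\<bar>D\<bar> + \<bar>E\<bar>)"])
    fix c :: real assume c: "c > 0"
    have "(\<lambda>n. ennreal c * (\<integral>\<^sup>+x. ennreal (norm (v n x) powr r) \<partial>M)) \<longlonglongrightarrow> ennreal c * 0"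
      by (intro ennreal_tendsto_cmult v(3)) auto
    then have "\<forall>\<^sub>F n in sequentially. ennreal c * (\<integral>\<^sup>+x. ennreal (norm (v n x) powr r) \<partial>M) < 1"
      by (rule order_tendstoD) simp
    then obtain n where n: "ennreal c * (\<integral>\<^sup>+x. ennreal (norm (v n x) powr r) \<partial>M) \<le> 1"
      using eventually_happens'[OF sequentially_bot] less_imp_le by blast
    have w: "(\<lambda>x. u x - v n x) \<in> Lp_space (ennreal r) M" using v(2) by blast
    \<comment> \<open>The argument on the left is \<open>u\<close>, written as a sum so that
      additivity applies.\<close>
    have "AE z in N. S (\<lambda>x. v n x + (u x - v n x)) z = S (v n) z + S (\<lambda>x. u x - v n x) z"
      "AE z in N. T (\<lambda>x. v n x + (u x - v n x)) z = T (v n) z + T (\<lambda>x. u x - v n x) z"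
      by (rule bounded_Lp_operator_add[OF S v(1) w], rule bounded_Lp_operator_add[OF T v(1) w])
    with eq[OF v(2), of n] have "AE z in N. S u z - T u z = S (v n) z - T (v n) z"
      by eventually_elim simp
    then have "?s \<le> (\<integral>\<^sup>+z. ennreal (2 powr r) * (ennreal (norm (S (v n) z) powr r) + ennreal (norm (T (v n) z) powr r)) \<partial>N)"
    proof (intro nn_integral_mono_AE, eventually_elim)
      case (elim z)
      then show ?case
        using norm_diff_powr_le[OF r, of "S (v n) z" "T (v n) z"]
        by (simp add: ennreal_mult'[symmetric] flip: ennreal_plus)
    qed
    also have "\<dots> = ennreal (2 powr r) * ((\<integral>\<^sup>+z. ennreal (norm (S (v n) z) powr r) \<partial>N) +
        (\<integral>\<^sup>+z. ennreal (norm (T (v n) z) powr r) \<partial>N))"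
      using meas[OF v(1)[of n]] by (simp add: nn_integral_cmult nn_integral_add)
    finally have "ennreal c * ?s \<le> ennreal c * (ennreal (2 powr r) * ((\<integral>\<^sup>+z. ennreal (norm (S (v n) z) powr r) \<partial>N) +
        (\<integral>\<^sup>+z. ennreal (norm (T (v n) z) powr r) \<partial>N)))"
      by (rule mult_left_mono) simp
    also have "\<dots> = ennreal (2 powr r) * (ennreal c * (\<integral>\<^sup>+z. ennreal (norm (S (v n) z) powr r) \<partial>N) +
        ennreal c * (\<integral>\<^sup>+z. ennreal (norm (T (v n) z) powr r) \<partial>N))"
      by (simp add: distrib_left mult_ac)
    also have "\<dots> \<le> ennreal (2 powr r) * (ennreal \<bar>D\<bar> + ennreal \<bar>E\<bar>)"
      using D[OF v(1) c n] E[OF v(1) c n]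
      by (intro mult_left_mono add_mono) (auto elim: order_trans intro: ennreal_leI)
    also have "\<dots> = ennreal (2 powr r * (\<bar>D\<bar> + \<bar>E\<bar>))"
      by (simp add: ennreal_mult)
    finally show "ennreal c * ?s \<le> ennreal (2 powr r * (\<bar>D\<bar> + \<bar>E\<bar>))" .
  qed
  then have "AE z in N. ennreal (norm (S u z - T u z) powr r) = 0"
    by (subst (asm) nn_integral_0_iff_AE) auto
  then show ?thesis by eventually_elim simp
qed

section \<open>The Poisson integral operator\<close>

text \<open>No integrability is assumed: where the integral diverges,
  \<open>poisson_integral\<close> has the default value 0 and the bound is trivial.\<close>

lemma norm_poisson_integral_le:
  assumes "Im z > 0"
  shows "ennreal (norm (poisson_integral u z)) \<le> poisson_nn_integral (\<lambda>t. ennreal (norm (u t))) z"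
proof (cases "integrable lebesgue (\<lambda>t. complex_of_real (poisson_kernel (Re z - t) (Im z)) * u t)")
  case True
  from integral_norm_bound_ennreal[OF True] show ?thesis
    using assms by (simp add: poisson_integral_def poisson_nn_integral_def norm_mult ennreal_mult poisson_kernel_nonneg)
qed (simp add: poisson_integral_def not_integrable_integral_eq)

lemma borel_measurable_poisson_integral:
  assumes [measurable]: "u \<in> borel_measurable lebesgue"
  shows "poisson_integral u \<in> borel_measurable borel"
  unfolding poisson_integral_def[abs_def] by measurable

text \<open>For finite exponents |u| is at most |u|^r + 1. The first summand is integrable and the
  kernel is bounded; the second has Poisson integral 1. This takes the place of Hoelder's
  inequality.\<close>

lemma poisson_nn_integral_Lp_finite:
  assumes p: "p \<ge> 1" and u: "u \<in> Lp_space p lebesgue" and z: "Im z > 0"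
  shows "poisson_nn_integral (\<lambda>t. ennreal (norm (u t))) z < \<infinity>"
proof -
  have [measurable]: "u \<in> borel_measurable lebesgue" using u by (simp add: Lp_space_def)
  show ?thesis
  proof (cases p)
    case (real r)
    then have r: "r \<ge> 1" "p = ennreal r" using p by simp_all
    then have fin: "(\<integral>\<^sup>+t. ennreal (norm (u t) powr r) \<partial>lebesgue) < \<infinity>"
      using u by (simp add: Lp_space_ennreal_iff)
    have "norm (u t) \<le> norm (u t) powr r + 1" for t
    proof (cases "norm (u t) \<le> 1")
      case False
      then have "norm (u t) powr 1 \<le> norm (u t) powr r" using r by (intro powr_mono) auto
      then show ?thesis by simp
    qed (simp add: add_increasing)
    then have "poisson_nn_integral (\<lambda>t. ennreal (norm (u t))) z
        \<le> poisson_nn_integral (\<lambda>t. ennreal (norm (u t) powr r) + 1) z"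
      by (intro poisson_nn_integral_mono_AE AE_I2) (metis ennreal_1 ennreal_leI ennreal_plus powr_ge_zero zero_le_one)
    also have "\<dots> = poisson_nn_integral (\<lambda>t. ennreal (norm (u t) powr r)) z + 1"
      using z by (subst poisson_nn_integral_add) (auto simp: poisson_nn_integral_const)
    also have "\<dots> \<le> ennreal (1 / (pi * Im z)) * (\<integral>\<^sup>+t. ennreal (norm (u t) powr r) \<partial>lebesgue) + 1"
      using z by (intro add_mono poisson_nn_integral_le_nn_integral) auto
    also have "\<dots> < \<infinity>" using fin by (simp add: ennreal_mult_less_top)
    finally show ?thesis .
  next
    case top
    have "poisson_nn_integral (\<lambda>t. ennreal (norm (u t))) z
        \<le> poisson_nn_integral (\<lambda>t. esssup lebesgue (\<lambda>x. ennreal (norm (u x)))) z"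
      by (intro poisson_nn_integral_mono_AE esssup_AE)
    also have "\<dots> < \<infinity>"
      using u z top by (simp add: poisson_nn_integral_const Lp_space_def Lp_norm_def)
    finally show ?thesis .
  qed
qed

lemma integrable_poisson_integrand:
  assumes p: "p \<ge> 1" and u: "u \<in> Lp_space p lebesgue" and z: "Im z > 0"
  shows "integrable lebesgue (\<lambda>t. complex_of_real (poisson_kernel (Re z - t) (Im z)) * u t)"
proof (rule integrableI_bounded)
  have [measurable]: "u \<in> borel_measurable lebesgue" using u by (simp add: Lp_space_def)
  show "(\<lambda>t. complex_of_real (poisson_kernel (Re z - t) (Im z)) * u t) \<in> borel_measurable lebesgue"
    by measurable
  show "(\<integral>\<^sup>+t. ennreal (norm (complex_of_real (poisson_kernel (Re z - t) (Im z)) * u t)) \<partial>lebesgue) < \<infinity>"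
    using poisson_nn_integral_Lp_finite[OF assms] z
    by (simp add: poisson_nn_integral_def norm_mult ennreal_mult poisson_kernel_nonneg)
qed

lemma poisson_integral_add:
  assumes "p \<ge> 1" "u \<in> Lp_space p lebesgue" "v \<in> Lp_space p lebesgue" "Im z > 0"
  shows "poisson_integral (\<lambda>t. u t + v t) z = poisson_integral u z + poisson_integral v z"
  using integrable_poisson_integrand[OF assms(1,2,4)] integrable_poisson_integrand[OF assms(1,3,4)]
  by (simp add: poisson_integral_def distrib_left)

lemma poisson_integral_diff:
  assumes "p \<ge> 1" "u \<in> Lp_space p lebesgue" "v \<in> Lp_space p lebesgue" "Im z > 0"
  shows "poisson_integral (\<lambda>t. u t - v t) z = poisson_integral u z - poisson_integral v z"
  using integrable_poisson_integrand[OF assms(1,2,4)] integrable_poisson_integrand[OF assms(1,3,4)]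
  by (simp add: poisson_integral_def right_diff_distrib)

lemma poisson_integral_cmult: "poisson_integral (\<lambda>t. c * u t) z = c * poisson_integral u z"
  unfolding poisson_integral_def by (simp add: mult.left_commute)

lemma poisson_integral_cong_AE:
  assumes [measurable]: "u \<in> borel_measurable lebesgue" "v \<in> borel_measurable lebesgue"
    and "AE t in lebesgue. u t = v t"
  shows "poisson_integral u z = poisson_integral v z"
  unfolding poisson_integral_def using assms(3) by (intro integral_cong_AE) auto

lemma well_projected_half_plane_Im_pos:
  "\<mu> \<in> well_projected upper_half_plane kx ky \<Longrightarrow> z \<in> space \<mu> \<Longrightarrow> Im z > 0"
  by (simp add: well_projected_sets_space(2) upper_half_plane_def)

section \<open>Weak type estimate and continuity on \<open>L^1\<close>\<close>

lemma weak_L1_norm_poisson_integral_le: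
  assumes \<mu>: "\<mu> \<in> well_projected upper_half_plane kx ky" and k: "kx \<ge> 0" "ky \<ge> 0"
    and u: "u \<in> Lp_space 1 lebesgue"
  shows "weak_L1_norm \<mu> (poisson_integral u) \<le> ennreal (3 * kx + ky / pi) * Lp_norm 1 lebesgue u"
  unfolding weak_L1_norm_def
proof (rule SUP_least)
  fix l :: real assume "l \<in> {0<..}"
  then have l: "l > 0" by simp
  have [measurable]: "u \<in> borel_measurable lebesgue" and fin: "(\<integral>\<^sup>+t. ennreal (norm (u t)) \<partial>lebesgue) < \<infinity>"
    using u by (simp_all add: Lp_space_def Lp_norm_1)
  let ?P = "poisson_nn_integral (\<lambda>t. ennreal (norm (u t)))"
  have "?P \<in> borel_measurable \<mu>"
    by (rule measurable_well_projected[OF \<mu>]) measurable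
  then have "{z\<in>space \<mu>. ennreal l < ?P z} \<in> sets \<mu>" by measurable
  moreover have "{z\<in>space \<mu>. norm (poisson_integral u z) > l} \<subseteq> {z\<in>space \<mu>. ennreal l < ?P z}"
  proof safe
    fix z assume z: "z \<in> space \<mu>" "norm (poisson_integral u z) > l"
    have "ennreal l < ennreal (norm (poisson_integral u z))"
      using z(2) l by (simp add: ennreal_less_iff)
    also have "\<dots> \<le> ?P z"
      by (rule norm_poisson_integral_le[OF well_projected_half_plane_Im_pos[OF \<mu> z(1)]])
    finally show "ennreal l < ?P z" .
  qed
  ultimately have "ennreal l * emeasure \<mu> {z\<in>space \<mu>. norm (poisson_integral u z) > l}
      \<le> ennreal l * emeasure \<mu> {z\<in>space \<mu>. ennreal l < ?P z}"
    by (intro mult_left_mono emeasure_mono) auto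
  also have "\<dots> \<le> ennreal (3 * kx + ky / pi) * Lp_norm 1 lebesgue u"
    unfolding Lp_norm_1 by (rule poisson_nn_integral_weak_type[OF \<mu> k _ fin l]) measurable
  finally show "ennreal l * emeasure \<mu> {z\<in>space \<mu>. norm (poisson_integral u z) > l}
      \<le> ennreal (3 * kx + ky / pi) * Lp_norm 1 lebesgue u" .
qed

lemma poisson_integral_weak_L1_space:
  assumes \<mu>: "\<mu> \<in> well_projected upper_half_plane kx ky" and k: "kx \<ge> 0" "ky \<ge> 0"
    and u: "u \<in> Lp_space 1 lebesgue"
  shows "poisson_integral u \<in> weak_L1_space \<mu>"
proof -
  have "ennreal (3 * kx + ky / pi) * Lp_norm 1 lebesgue u < \<infinity>"
    using u by (simp add: Lp_space_def ennreal_mult_less_top)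
  with weak_L1_norm_poisson_integral_le[OF assms] have "weak_L1_norm \<mu> (poisson_integral u) < \<infinity>"
    by (rule le_less_trans)
  moreover have "poisson_integral u \<in> borel_measurable \<mu>"
    using u by (intro measurable_well_projected[OF \<mu>] borel_measurable_poisson_integral) (simp add: Lp_space_def)
  ultimately show ?thesis by (simp add: weak_L1_space_def)
qed

lemma weak_L1_norm_cong:
  "(\<And>z. z \<in> space M \<Longrightarrow> f z = g z) \<Longrightarrow> weak_L1_norm M f = weak_L1_norm M g"
  unfolding weak_L1_norm_def by (intro SUP_cong refl arg_cong2[where f = "(*)"] arg_cong2[where f = emeasure]) auto

lemma Lp_space_1_diff:
  assumes "u \<in> Lp_space 1 M" "v \<in> Lp_space 1 M"
  shows "(\<lambda>x. u x - v x) \<in> Lp_space 1 M"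
proof -
  have [measurable]: "u \<in> borel_measurable M" "v \<in> borel_measurable M"
    using assms by (simp_all add: Lp_space_def)
  have "(\<integral>\<^sup>+x. ennreal (norm (u x - v x)) \<partial>M) \<le> (\<integral>\<^sup>+x. ennreal (norm (u x)) + ennreal (norm (v x)) \<partial>M)"
    by (intro nn_integral_mono) (simp add: norm_triangle_ineq4 flip: ennreal_plus)
  also have "\<dots> = (\<integral>\<^sup>+x. ennreal (norm (u x)) \<partial>M) + (\<integral>\<^sup>+x. ennreal (norm (v x)) \<partial>M)"
    by (rule nn_integral_add) measurable
  also have "\<dots> < \<infinity>" using assms by (simp add: Lp_space_def Lp_norm_1)
  finally show ?thesis by (simp add: Lp_space_def Lp_norm_1)
qed

text \<open>By linearity, which holds at every point of the half-plane, the difference is the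
  Poisson integral of \<open>w n - u\<close>, and the weak type estimate applies to it. Thus no
  triangle inequality for the weak quasi-norm enters.\<close>

lemma poisson_integral_weak_L1_continuous:
  assumes \<mu>: "\<mu> \<in> well_projected upper_half_plane kx ky" and k: "kx \<ge> 0" "ky \<ge> 0"
    and u: "u \<in> Lp_space 1 lebesgue" and w: "\<And>n. w n \<in> Lp_space 1 lebesgue"
    and lim: "(\<lambda>n. Lp_norm 1 lebesgue (\<lambda>t. w n t - u t)) \<longlonglongrightarrow> 0"
  shows "(\<lambda>n. weak_L1_norm \<mu> (\<lambda>z. poisson_integral (w n) z - poisson_integral u z)) \<longlonglongrightarrow> 0"
proof (rule tendsto_sandwich[OF _ _ tendsto_const])
  have "(\<lambda>n. ennreal (3 * kx + ky / pi) * Lp_norm 1 lebesgue (\<lambda>t. w n t - u t)) \<longlonglongrightarrow> ennreal (3 * kx + ky / pi) * 0"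
    by (intro ennreal_tendsto_cmult lim) simp
  then show "(\<lambda>n. ennreal (3 * kx + ky / pi) * Lp_norm 1 lebesgue (\<lambda>t. w n t - u t)) \<longlonglongrightarrow> 0" by simp
  have "weak_L1_norm \<mu> (\<lambda>z. poisson_integral (w n) z - poisson_integral u z)
      \<le> ennreal (3 * kx + ky / pi) * Lp_norm 1 lebesgue (\<lambda>t. w n t - u t)" for n
  proof -
    have "weak_L1_norm \<mu> (\<lambda>z. poisson_integral (w n) z - poisson_integral u z)
        = weak_L1_norm \<mu> (poisson_integral (\<lambda>t. w n t - u t))"
      by (intro weak_L1_norm_cong poisson_integral_diff[OF order.refl, symmetric] w u
          well_projected_half_plane_Im_pos[OF \<mu>])
    then show ?thesis
      using weak_L1_norm_poisson_integral_le[OF \<mu> k Lp_space_1_diff[OF w u]] by simp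
  qed
  then show "\<forall>\<^sub>F n in sequentially. weak_L1_norm \<mu> (\<lambda>z. poisson_integral (w n) z - poisson_integral u z)
      \<le> ennreal (3 * kx + ky / pi) * Lp_norm 1 lebesgue (\<lambda>t. w n t - u t)" by simp
qed simp

section \<open>Strong type estimates and the bounded extension\<close>

lemma Lp_norm_infinity_poisson_integral_le:
  assumes \<mu>: "\<mu> \<in> well_projected upper_half_plane kx ky" and u: "u \<in> Lp_space \<infinity> lebesgue"
  shows "Lp_norm \<infinity> \<mu> (poisson_integral u) \<le> Lp_norm \<infinity> lebesgue u"
proof -
  have [measurable]: "u \<in> borel_measurable lebesgue" using u by (simp add: Lp_space_def)
  have [measurable]: "poisson_integral u \<in> borel_measurable \<mu>"
    by (intro measurable_well_projected[OF \<mu>] borel_measurable_poisson_integral) measurable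
  have "ennreal (norm (poisson_integral u z)) \<le> Lp_norm \<infinity> lebesgue u" if "z \<in> space \<mu>" for z
  proof -
    have z: "Im z > 0" by (rule well_projected_half_plane_Im_pos[OF \<mu> that])
    have "ennreal (norm (poisson_integral u z)) \<le> poisson_nn_integral (\<lambda>t. ennreal (norm (u t))) z"
      by (rule norm_poisson_integral_le[OF z])
    also have "\<dots> \<le> poisson_nn_integral (\<lambda>t. esssup lebesgue (\<lambda>x. ennreal (norm (u x)))) z"
      by (intro poisson_nn_integral_mono_AE esssup_AE)
    also have "\<dots> = Lp_norm \<infinity> lebesgue u"
      using z by (simp add: poisson_nn_integral_const Lp_norm_def)
    finally show ?thesis .
  qed
  then show ?thesis
    by (subst Lp_norm_def) auto
qed

lemma nn_integral_poisson_integral_powr_le: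
  assumes \<mu>: "\<mu> \<in> well_projected upper_half_plane kx ky" and k: "kx \<ge> 0" "ky \<ge> 0" and r: "r > 1"
    and u: "u \<in> Lp_space (ennreal r) lebesgue"
  shows "(\<integral>\<^sup>+z. ennreal (norm (poisson_integral u z) powr r) \<partial>\<mu>) \<le>
    ennreal (2 powr r * ((3 * kx + ky / pi) * (r / (r - 1)))) * (\<integral>\<^sup>+t. ennreal (norm (u t) powr r) \<partial>lebesgue)"
proof -
  have [measurable]: "u \<in> borel_measurable lebesgue" and fin: "(\<integral>\<^sup>+t. ennreal (norm (u t) powr r) \<partial>lebesgue) < \<infinity>"
    using u r by (simp_all add: Lp_space_ennreal_iff)
  have [measurable]: "poisson_integral u \<in> borel_measurable \<mu>"
    by (intro measurable_well_projected[OF \<mu>] borel_measurable_poisson_integral) measurable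
  show ?thesis
    by (rule poisson_nn_integral_strong_type[OF \<mu> k r _ _ fin])
      (auto intro: norm_poisson_integral_le well_projected_half_plane_Im_pos[OF \<mu>])
qed

text \<open>At \<open>p = \<infinity>\<close> nothing is recorded about \<open>p'\<close>: the
  exponent 1 / p is then 0, and \<open>enn_powr\<close> with exponent 0 is 1 for every base.\<close>

lemma conjugate_exponent_cases:
  fixes p p' :: ennreal
  assumes "1 < p" "inverse p + inverse p' = 1"
  obtains "p = \<infinity>" | r where "r > 1" "p = ennreal r" "p' = ennreal (r / (r - 1))"
proof (cases p)
  case (real r)
  then have r: "r > 1" using assms(1) by simp
  have ip: "inverse p = ennreal (inverse r)" using r real by (simp add: inverse_ennreal)
  have "p' = ennreal (r / (r - 1))"
  proof (cases p')
    case (real s)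
    then have "s \<noteq> 0" using assms(2) by auto
    with real have s: "s > 0" by simp
    then have "ennreal (inverse r + inverse s) = 1"
      using assms(2) ip real r by (simp add: inverse_ennreal)
    then have "inverse r + inverse s = 1" by simp
    then have "s = r / (r - 1)" using r s by (simp add: field_simps)
    then show ?thesis using real by simp
  next
    case top
    then show ?thesis using assms(2) ip r by simp
  qed
  then show thesis using that(2) r real by blast
qed (use that(1) in simp)

lemma Lp_poisson_integral:
  assumes \<mu>: "\<mu> \<in> well_projected upper_half_plane kx ky" and k: "kx \<ge> 0" "ky \<ge> 0"
    and p: "1 < p" "inverse p + inverse p' = 1" and u: "u \<in> Lp_space p lebesgue"
  shows "poisson_integral u \<in> Lp_space p \<mu>"
    and "Lp_norm p lebesgue u \<le> 1 \<Longrightarrow>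
      Lp_norm p \<mu> (poisson_integral u) \<le> 2 * enn_powr (ennreal (3 * kx + ky / pi) * p') (enn2real (inverse p))"
proof -
  have [measurable]: "u \<in> borel_measurable lebesgue" using u by (simp add: Lp_space_def)
  have meas: "poisson_integral u \<in> borel_measurable \<mu>"
    by (intro measurable_well_projected[OF \<mu>] borel_measurable_poisson_integral) measurable
  have "poisson_integral u \<in> Lp_space p \<mu> \<and> (Lp_norm p lebesgue u \<le> 1 \<longrightarrow>
      Lp_norm p \<mu> (poisson_integral u) \<le> 2 * enn_powr (ennreal (3 * kx + ky / pi) * p') (enn2real (inverse p)))"
    using p
  proof (cases rule: conjugate_exponent_cases)
    case 1
    have le: "Lp_norm \<infinity> \<mu> (poisson_integral u) \<le> Lp_norm \<infinity> lebesgue u"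
      using Lp_norm_infinity_poisson_integral_le[OF \<mu>] u 1 by simp
    moreover have "Lp_norm \<infinity> lebesgue u < \<infinity>" using u 1 by (simp add: Lp_space_def)
    ultimately have "poisson_integral u \<in> Lp_space p \<mu>"
      using 1 meas by (auto simp: Lp_space_def intro: le_less_trans)
    \<comment> \<open>For \<open>p = \<infinity>\<close> the claimed bound is 2, while the Poisson
      integral is a contraction.\<close>
    moreover have "(1::ennreal) \<le> 2" by simp
    ultimately show ?thesis using le 1 by (auto simp: enn_powr_def intro: order_trans)
  next
    case (2 r)
    let ?C = "3 * kx + ky / pi"
    have C0: "?C \<ge> 0" using k by simp
    have C: "?C * (r / (r - 1)) \<ge> 0" using k 2(1) by simp
    note le = nn_integral_poisson_integral_powr_le[OF \<mu> k 2(1) u[unfolded 2(2)]]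
    have "(\<integral>\<^sup>+t. ennreal (norm (u t) powr r) \<partial>lebesgue) < \<infinity>"
      using u 2 by (simp add: Lp_space_ennreal_iff)
    then have "(\<integral>\<^sup>+z. ennreal (norm (poisson_integral u z) powr r) \<partial>\<mu>) < \<infinity>"
      by (intro le_less_trans[OF le]) (simp add: ennreal_mult_less_top)
    then have "poisson_integral u \<in> Lp_space p \<mu>"
      using 2(1,2) meas by (simp add: Lp_space_ennreal_iff)
    moreover have "Lp_norm p \<mu> (poisson_integral u) \<le> 2 * enn_powr (ennreal ?C * p') (enn2real (inverse p))"
      if "Lp_norm p lebesgue u \<le> 1"
    proof -
      have "(\<integral>\<^sup>+t. ennreal (norm (u t) powr r) \<partial>lebesgue) \<le> 1"
        using that 2(1,2) by (simp add: Lp_norm_ennreal_le_1_iff)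
      then have "(\<integral>\<^sup>+z. ennreal (norm (poisson_integral u z) powr r) \<partial>\<mu>)
          \<le> ennreal (2 powr r * (?C * (r / (r - 1)))) * 1"
        by (intro order_trans[OF le] mult_left_mono) auto
      then have "Lp_norm p \<mu> (poisson_integral u) \<le> enn_powr (ennreal (2 powr r * (?C * (r / (r - 1))))) (1 / r)"
        using 2(1,2) by (simp only: Lp_norm_ennreal mult_1_right) (simp add: Lp_norm_ennreal enn_powr_mono)
      also have "\<dots> = ennreal ((2 powr r * (?C * (r / (r - 1)))) powr (1 / r))"
        using C0 2(1) by (intro enn_powr_ennreal mult_nonneg_nonneg) simp_all
      also have "(2 powr r * (?C * (r / (r - 1)))) powr (1 / r) = 2 * (?C * (r / (r - 1))) powr (1 / r)"
        using C0 2(1) by (subst powr_mult) (simp_all add: powr_powr)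
      also have "ennreal \<dots> = 2 * ennreal ((?C * (r / (r - 1))) powr (1 / r))"
        by (simp add: ennreal_mult)
      also have "ennreal ((?C * (r / (r - 1))) powr (1 / r)) = enn_powr (ennreal (?C * (r / (r - 1)))) (1 / r)"
        using C 2(1) by (intro enn_powr_ennreal[symmetric]) simp_all
      also have "ennreal (?C * (r / (r - 1))) = ennreal ?C * p'"
        unfolding 2(3) using k 2(1) by (intro ennreal_mult) auto
      also have "1 / r = enn2real (inverse p)"
        unfolding 2(2) using 2(1) by (simp add: inverse_ennreal inverse_eq_divide)
      finally show ?thesis .
    qed
    ultimately show ?thesis by blast
  qed
  then show "poisson_integral u \<in> Lp_space p \<mu>"
    and "Lp_norm p lebesgue u \<le> 1 \<Longrightarrow>
      Lp_norm p \<mu> (poisson_integral u) \<le> 2 * enn_powr (ennreal (3 * kx + ky / pi) * p') (enn2real (inverse p))"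
    by blast+
qed

lemma bounded_Lp_operator_poisson_integral:
  assumes \<mu>: "\<mu> \<in> well_projected upper_half_plane kx ky" and k: "kx \<ge> 0" "ky \<ge> 0"
    and p: "1 < p" "inverse p + inverse p' = 1"
  shows "bounded_Lp_operator p lebesgue \<mu> poisson_integral"
proof -
  have p1: "1 \<le> p" using p(1) by simp
  note pos = well_projected_half_plane_Im_pos[OF \<mu>]
  have "op_norm p lebesgue \<mu> poisson_integral \<le> 2 * enn_powr (ennreal (3 * kx + ky / pi) * p') (enn2real (inverse p))"
    unfolding op_norm_def using Lp_poisson_integral(2)[OF \<mu> k p] by (intro SUP_least) auto
  also have "\<dots> < \<infinity>"
    using p by (cases rule: conjugate_exponent_cases)
      (auto simp: enn_powr_def ennreal_mult_less_top ennreal_mult_eq_top_iff)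
  finally show ?thesis
    unfolding bounded_Lp_operator_def
  proof (intro conjI ballI allI impI)
    fix u v :: "real \<Rightarrow> complex"
    assume u: "u \<in> Lp_space p lebesgue" and v: "v \<in> Lp_space p lebesgue"
    show "AE z in \<mu>. poisson_integral (\<lambda>x. u x + v x) z = poisson_integral u z + poisson_integral v z"
      by (intro AE_I2 poisson_integral_add[OF p1 u v] pos)
    assume "AE x in lebesgue. u x = v x"
    then show "AE z in \<mu>. poisson_integral u z = poisson_integral v z"
      using u v by (simp add: Lp_space_def poisson_integral_cong_AE[of u v])
  qed (auto intro: Lp_poisson_integral(1)[OF \<mu> k p] simp: poisson_integral_cmult)
qed

lemma poisson_extensions_eq_AE:
  assumes \<mu>: "\<mu> \<in> well_projected upper_half_plane kx ky" and k: "kx \<ge> 0" "ky \<ge> 0"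
    and p: "1 < p" "inverse p + inverse p' = 1"
    and T: "T \<in> poisson_extensions p \<mu>" and u: "u \<in> Lp_space p lebesgue"
  shows "AE z in \<mu>. T u z = poisson_integral u z"
  using p
proof (cases rule: conjugate_exponent_cases)
  case 1
  \<comment> \<open>At \<open>p = \<infinity>\<close> the initial domain is already the whole space,
    so no density argument is needed; it is confined to finite exponents.\<close>
  then show ?thesis using T u by (simp add: poisson_extensions_def)
next
  case (2 r)
  show ?thesis
  proof (rule bounded_Lp_operator_eqI[where r = r and M = lebesgue and S = T and T = poisson_integral and u = u])
    show "bounded_Lp_operator (ennreal r) lebesgue \<mu> T"
      using T 2(2) by (simp add: poisson_extensions_def)
    show "bounded_Lp_operator (ennreal r) lebesgue \<mu> poisson_integral"
      using bounded_Lp_operator_poisson_integral[OF \<mu> k p] 2(2) by simp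
  qed (use T u 2 in \<open>auto simp: poisson_extensions_def\<close>)
qed

lemma K3_le:
  assumes k: "kx \<ge> 0" "ky \<ge> 0" and p: "1 < p" "inverse p + inverse p' = 1"
  shows "K3 p kx ky \<le> 2 * enn_powr (ennreal (3 * kx + ky / pi) * p') (enn2real (inverse p))"
  unfolding K3_def op_norm_def
proof (intro SUP_least)
  fix \<mu> T and u :: "real \<Rightarrow> complex"
  assume \<mu>: "\<mu> \<in> well_projected upper_half_plane kx ky" and T: "T \<in> poisson_extensions p \<mu>"
    and u: "u \<in> {u \<in> Lp_space p lebesgue. Lp_norm p lebesgue u \<le> 1}"
  have "Lp_norm p \<mu> (T u) = Lp_norm p \<mu> (poisson_integral u)"
  proof (rule Lp_norm_cong_AE)
    show "T u \<in> borel_measurable \<mu>"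
      using T u by (auto simp: poisson_extensions_def bounded_Lp_operator_def Lp_space_def)
    show "poisson_integral u \<in> borel_measurable \<mu>"
      using Lp_poisson_integral(1)[OF \<mu> k p] u by (auto simp: Lp_space_def)
    show "AE z in \<mu>. T u z = poisson_integral u z"
      using poisson_extensions_eq_AE[OF \<mu> k p T] u by simp
  qed
  then show "Lp_norm p \<mu> (T u) \<le> 2 * enn_powr (ennreal (3 * kx + ky / pi) * p') (enn2real (inverse p))"
    using Lp_poisson_integral(2)[OF \<mu> k p] u by simp
qed

theorem theorem4:
  fixes kx ky :: real and \<mu> :: "complex measure"
  assumes "kx \<ge> 0" and "ky \<ge> 0"
    and "\<mu> \<in> well_projected upper_half_plane kx ky"
  shows
    "((\<forall>u\<in>Lp_space 1 lebesgue.
         poisson_integral u \<in> weak_L1_space \<mu> \<and>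
         weak_L1_norm \<mu> (poisson_integral u) \<le> ennreal (3 * kx + ky / pi) * Lp_norm 1 lebesgue u) \<and>
      (\<forall>u\<in>Lp_space 1 lebesgue. \<forall>w :: nat \<Rightarrow> real \<Rightarrow> complex.
         (\<forall>n. w n \<in> Lp_space 1 lebesgue) \<longrightarrow>
         (\<lambda>n. Lp_norm 1 lebesgue (\<lambda>t. w n t - u t)) \<longlonglongrightarrow> 0 \<longrightarrow>
         (\<lambda>n. weak_L1_norm \<mu> (\<lambda>z. poisson_integral (w n) z - poisson_integral u z)) \<longlonglongrightarrow> 0))
     \<and>
     (\<forall>p p' :: ennreal. 1 < p \<longrightarrow> inverse p + inverse p' = 1 \<longrightarrow>
        (\<exists>T. T \<in> poisson_extensions p \<mu>) \<and>
        K3 p kx ky \<le> 2 * enn_powr (ennreal (3 * kx + ky / pi) * p') (enn2real (inverse p)))"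
proof (intro conjI ballI allI impI)
  note assms' = assms(3,1,2)
  fix u :: "real \<Rightarrow> complex" assume u: "u \<in> Lp_space 1 lebesgue"
  show "poisson_integral u \<in> weak_L1_space \<mu>"
    by (rule poisson_integral_weak_L1_space[OF assms' u])
  show "weak_L1_norm \<mu> (poisson_integral u) \<le> ennreal (3 * kx + ky / pi) * Lp_norm 1 lebesgue u"
    by (rule weak_L1_norm_poisson_integral_le[OF assms' u])
  fix w :: "nat \<Rightarrow> real \<Rightarrow> complex"
  assume "\<forall>n. w n \<in> Lp_space 1 lebesgue"
    and "(\<lambda>n. Lp_norm 1 lebesgue (\<lambda>t. w n t - u t)) \<longlonglongrightarrow> 0"
  then show "(\<lambda>n. weak_L1_norm \<mu> (\<lambda>z. poisson_integral (w n) z - poisson_integral u z)) \<longlonglongrightarrow> 0"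
    by (intro poisson_integral_weak_L1_continuous[OF assms' u]) auto
next
  fix p p' :: ennreal assume p: "1 < p" "inverse p + inverse p' = 1"
  show "\<exists>T. T \<in> poisson_extensions p \<mu>"
    \<comment> \<open>The Poisson integral is its own extension, the defining integral being
      meaningful on all of \<open>L^p\<close>.\<close>
    using bounded_Lp_operator_poisson_integral[OF assms(3,1,2) p] by (auto simp: poisson_extensions_def)
  show "K3 p kx ky \<le> 2 * enn_powr (ennreal (3 * kx + ky / pi) * p') (enn2real (inverse p))"
    by (rule K3_le[OF assms(1,2) p])
qed

end
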